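(* Let $n\ge0$ and $d\ge3$ be integers and let $p\in(0,1)$. Then $$\omega\left(\mathbf{multiEMaMu}\bigl(d;\,n,\,n^{d\frac{1-p}{p}}\bigr)\right)\le\frac1p\Bigl[\log\bigl(n^d+2n^{d-1}+n^2(n+1)^{d-3}+1\bigr)-h(p)\Bigr],$$ where $h(p)=-p\log(p)-(1-p)\log(1-p)$ and $\log=\log_2$.
   Context: All vector spaces are finite dimensional over $\mathbb{C}$. For a tensor $T\in V_1\otimes\cdots\otimes V_k$, the tensor rank $\mathrm{R}(T)$ is the least $r$ such that $T$ is a sum of $r$ tensors of the form $v_1\otimes\cdots\otimes v_k$. The border rank $\underline{\mathrm{R}}(T)$ is the least $r$ such that $T$ is a limit (Euclidean topology) of tensors of rank $r$. The Kronecker product $T\boxtimes S\in(V_1\otimes W_1)\otimes\cdots\otimes(V_k\otimes W_k)$ of $T\in V_1\otimes\cdots\otimes V_k$ and $S\in W_1\otimes\cdots\otimes W_k$ is $T\otimes S$ regrouped as a $k$-tensor. The asymptotic rank is $\lim_{N\to\infty}\mathrm{R}(T^{\boxtimes N})^{1/N}$ (the same value is obtained with $\underline{\mathrm{R}}$ in place of $\mathrm{R}$), and the exponent $\omega(T)$ is its base-2 logarithm. For integers $d,n,m$, the multi-extended matrix multiplication tensor is the $(d+1)$-tensor $$\mathbf{multiEMaMu}(d;n,m)=\sum_{i_1,\dots,i_d=1}^{n}\ \sum_{j=1}^{m} e_{i_1,j}\otimes e_{i_2,j}\otimes e_{i_3}\otimes\cdots\otimes e_{i_d}\otimes e_{i_1,\dots,i_d}\in\mathbb{C}^{nm}\otimes\mathbb{C}^{nm}\otimes(\mathbb{C}^{n})^{\otimes(d-2)}\otimes\mathbb{C}^{n^d},$$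 where the $e$'s denote basis vectors of the respective factors. It is the graph tensor on vertices $1,\dots,d+1$ with edges $\{q,d+1\}$ of weight $n$ for $q=1,\dots,d$ and the edge $\{1,2\}$ of weight $m$. It satisfies $\mathbf{multiEMaMu}(d;n,m)^{\boxtimes N}=\mathbf{multiEMaMu}(d;n^N,m^N)$ up to change of bases. Convention for non-integer weights: for nonnegative real weights, the statement $\omega(\mathbf{multiEMaMu}(d;n,m))\le\lambda$ means that $\underline{\mathrm{R}}(\mathbf{multiEMaMu}(d;n^N,m^N))\le2^{\lambda N+o(N)}$, where $N$ ranges over the positive integers for which $n^N$ and $m^N$ are integers. *)

theory Defs
  imports Complex_Main "HOL-Library.FuncSet" "HOL-Library.Landau_Symbols"
begin

text \<open>
  A tensor in V_1 \<otimes> ... \<otimes> V_k, where V_q has a basis labelled by the finite set I q, is given by its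
  coordinates: a function on the multi-indices x, where x q is a label in I q for q = 1, ..., k.
  Values outside this set of multi-indices (and values of a vector of V_q outside I q) are
  irrelevant and ignored by all notions below.
\<close>

definition multi_indices :: "nat \<Rightarrow> (nat \<Rightarrow> 'i set) \<Rightarrow> (nat \<Rightarrow> 'i) set" where
  "multi_indices k I = (\<Pi>\<^sub>E q\<in>{1..k}. I q)"

definition simple_tensor :: "nat \<Rightarrow> (nat \<Rightarrow> 'i \<Rightarrow> complex) \<Rightarrow> (nat \<Rightarrow> 'i) \<Rightarrow> complex" where
  "simple_tensor k v = (\<lambda>x. \<Prod>q=1..k. v q (x q))"

definition tensor_rank :: "nat \<Rightarrow> (nat \<Rightarrow> 'i set) \<Rightarrow> ((nat \<Rightarrow> 'i) \<Rightarrow> complex) \<Rightarrow> nat" where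
  "tensor_rank k I T = (LEAST r. \<exists>v :: nat \<Rightarrow> nat \<Rightarrow> 'i \<Rightarrow> complex.
     \<forall>x\<in>multi_indices k I. T x = (\<Sum>s<r. simple_tensor k (v s) x))"

text \<open>
  The coordinate space is finite dimensional, so Euclidean convergence is convergence of all
  coordinates.
\<close>

definition border_rank :: "nat \<Rightarrow> (nat \<Rightarrow> 'i set) \<Rightarrow> ((nat \<Rightarrow> 'i) \<Rightarrow> complex) \<Rightarrow> nat" where
  "border_rank k I T = (LEAST r. \<exists>X :: nat \<Rightarrow> (nat \<Rightarrow> 'i) \<Rightarrow> complex.
     (\<forall>t. tensor_rank k I (X t) = r) \<and>
     (\<forall>x\<in>multi_indices k I. (\<lambda>t. X t x) \<longlonglongrightarrow> T x))"

definition basis_vec :: "'i \<Rightarrow> 'i \<Rightarrow> complex" where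
  "basis_vec a = (\<lambda>b. if b = a then 1 else 0)"

text \<open>
  Basis vectors are labelled by lists of numbers: the label [i, j] stands for the pair i, j in the
  factors 1 and 2, [i] for i in the factors 3, ..., d, and [i_1, ..., i_d] for the d-tuple in the
  factor d + 1.  The definitions are meant for d at least 2.
\<close>

definition multiEMaMu_labels :: "nat \<Rightarrow> nat \<Rightarrow> nat \<Rightarrow> nat \<Rightarrow> nat list set" where
  "multiEMaMu_labels d n m q =
     (if q \<le> 2 then {[i, j] |i j. i \<in> {1..n} \<and> j \<in> {1..m}}
      else if q \<le> d then {[i] |i. i \<in> {1..n}}
      else {is. length is = d \<and> set is \<subseteq> {1..n}})"

definition multiEMaMu_label :: "nat \<Rightarrow> (nat \<Rightarrow> nat) \<Rightarrow> nat \<Rightarrow> nat \<Rightarrow> nat list" where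
  "multiEMaMu_label d i j q =
     (if q \<le> 2 then [i q, j] else if q \<le> d then [i q] else map i [1..<Suc d])"

definition multiEMaMu :: "nat \<Rightarrow> nat \<Rightarrow> nat \<Rightarrow> (nat \<Rightarrow> nat list) \<Rightarrow> complex" where
  "multiEMaMu d n m = (\<lambda>x. \<Sum>i\<in>{1..d} \<rightarrow>\<^sub>E {1..n}. \<Sum>j=1..m.
     simple_tensor (d + 1) (\<lambda>q. basis_vec (multiEMaMu_label d i j q)) x)"

definition multiEMaMu_border_rank :: "nat \<Rightarrow> nat \<Rightarrow> nat \<Rightarrow> nat" where
  "multiEMaMu_border_rank d n m =
     border_rank (d + 1) (multiEMaMu_labels d n m) (multiEMaMu d n m)"

text \<open>
  The assertion that the exponent of multiEMaMu(d; n, m) is at most c, for nonnegative real weights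
  n and m: the border rank of multiEMaMu(d; n^N, m^N) is at most 2^(c N + o(N)), where N ranges over
  the positive integers for which n^N and m^N are integers (called a and b below).
\<close>

definition multiEMaMu_exponent_le :: "nat \<Rightarrow> real \<Rightarrow> real \<Rightarrow> real \<Rightarrow> bool" where
  "multiEMaMu_exponent_le d n m c \<longleftrightarrow>
     (\<exists>f :: nat \<Rightarrow> real. f \<in> o(\<lambda>N. real N) \<and>
       (\<forall>N a b :: nat. N > 0 \<and> n ^ N = real a \<and> m ^ N = real b \<longrightarrow>
          real (multiEMaMu_border_rank d a b) \<le> 2 powr (c * real N + f N)))"

definition binary_entropy :: "real \<Rightarrow> real" where
  "binary_entropy p = - p * log 2 p - (1 - p) * log 2 (1 - p)"

end

theory Submission
  imports Defs "HOL-Real_Asymp.Real_Asymp"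
begin

text \<open>
  The proof reduces the bound to matrix multiplication and applies Schoenhage's method there.  The
  tensor \<open>multiEMaMu(d; a, b)\<close> is the matrix multiplication tensor
  \<open>multiEMaMu(2; a, b)\<close> on the factors \<open>1\<close>, \<open>2\<close>,
  \<open>d + 1\<close>, multiplied by one edge of weight \<open>a\<close> from
  \<open>d + 1\<close> to each of the factors \<open>3, ..., d\<close>
  (\<open>multiEMaMu_border_rank_le\<close>).  An edge costs at most its weight, and the same holds
  for a part of the edge \<open>{1, 2}\<close> that is split off.  Of the weight
  \<open>n^(d (1 - p) / p)\<close> of this edge, the part
  \<open>n^(2 (1 - p) / p)\<close> is kept for matrix multiplication.  The parts
  that are paid for in full contribute \<open>(d - 2) log n\<close> to the exponent from the factors
  \<open>3, ..., d\<close> and \<open>(d - 2) ((1 - p) / p) log n\<close> from the edge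
  \<open>{1, 2}\<close>, together \<open>(1 / p) (d - 2) log n\<close>.

  For matrix multiplication, let \<open>A = multiEMaMu(2; n, 1)\<close> and
  \<open>B = multiEMaMu(2; 1, n^2)\<close>.  Schoenhage's construction gives a tensor of rank
  \<open>n^2 + 2 n\<close> that equals \<open>A \<oplus> B\<close> up to mixed terms
  (\<open>rank_schoenhage\<close>).  In its \<open>N\<close>-th power the part with exactly
  \<open>k\<close> factors \<open>A\<close> consists of \<open>N choose k\<close> disjoint
  copies of \<open>A^k \<boxtimes> B^(N - k)\<close>, and the mixed terms vanish there by a
  counting argument (\<open>matmul_copies_schoenhage\<close>).  If
  \<open>s\<close> copies of a tensor have rank at most \<open>s q\<close>, then each further
  factor in a power of the tensor costs only \<open>q\<close> (\<open>matmul_copies_power\<close>).  With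
  \<open>k\<close> close to \<open>p N\<close> the number of copies is about
  \<open>2\<close> to the power \<open>N h(p)\<close> (\<open>binomial_mode\<close>), so the
  exponent of \<open>multiEMaMu(2; n, n^(2 (1 - p) / p))\<close> is at most
  \<open>(1 / p) (log (n^2 + 2 n) - h(p))\<close>.

  Altogether the exponent is at most
  \<open>(1 / p) (log ((n^2 + 2 n) n^(d - 2)) - h(p))\<close>, and
  \<open>(n^2 + 2 n) n^(d - 2) = n^d + 2 n^(d - 1)\<close> is, for \<open>n \<ge> 1\<close>,
  smaller than the base of the logarithm in the theorem.  For \<open>n = 0\<close> all tensors in
  question are zero.
\<close>

section \<open>Rank of tensors of order three\<close>

text \<open>
  Coordinates may have arbitrary types, and only those in the given sets count.  This makes every
  restriction needed below a mere reindexing of coordinates.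
\<close>
definition rank3_le ::
  "nat \<Rightarrow> 'a set \<Rightarrow> 'b set \<Rightarrow> 'c set \<Rightarrow> ('a \<Rightarrow> 'b \<Rightarrow> 'c \<Rightarrow> complex) \<Rightarrow> bool" where
  "rank3_le r A B C t \<longleftrightarrow> (\<exists>(u :: nat \<Rightarrow> 'a \<Rightarrow> complex) v w. \<forall>a\<in>A. \<forall>b\<in>B. \<forall>c\<in>C.
     (\<Sum>l<r. u l a * v l b * w l c) = t a b c)"

lemma rank3_leI:
  fixes u :: "'l \<Rightarrow> 'a \<Rightarrow> complex"
  assumes L: "finite L" "card L \<le> r"
    and t: "\<And>a b c. a \<in> A \<Longrightarrow> b \<in> B \<Longrightarrow> c \<in> C \<Longrightarrow> (\<Sum>l\<in>L. u l a * v l b * w l c) = t a b c"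
  shows "rank3_le r A B C t"
proof -
  obtain g where g: "bij_betw g {..<card L} L"
    using ex_bij_betw_nat_finite[OF L(1)] by (auto simp: atLeast0LessThan)
  define u' where "u' = (\<lambda>l a. if l < card L then u (g l) a else 0)"
  have "(\<Sum>l<r. u' l a * v (g l) b * w (g l) c) = t a b c" if "a \<in> A" "b \<in> B" "c \<in> C" for a b c
  proof -
    have "(\<Sum>l<r. u' l a * v (g l) b * w (g l) c)
        = (\<Sum>l<card L. u (g l) a * v (g l) b * w (g l) c)"
      using L(2) by (intro sum.mono_neutral_cong_right) (auto simp: u'_def)
    also have "\<dots> = (\<Sum>l\<in>L. u l a * v l b * w l c)"
      by (rule sum.reindex_bij_betw[OF g])
    finally show ?thesis using t that by simp
  qed
  then show ?thesis unfolding rank3_le_def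
    by (intro exI[of _ u'] exI[of _ "\<lambda>l. v (g l)"] exI[of _ "\<lambda>l. w (g l)"]) blast
qed

lemma rank3_leE:
  fixes t :: "'a \<Rightarrow> 'b \<Rightarrow> 'c \<Rightarrow> complex"
  assumes r: "rank3_le r A B C t" and L: "finite L" "r \<le> card L"
  obtains u :: "'l \<Rightarrow> 'a \<Rightarrow> complex" and v w
  where "\<And>a b c. a \<in> A \<Longrightarrow> b \<in> B \<Longrightarrow> c \<in> C \<Longrightarrow> (\<Sum>l\<in>L. u l a * v l b * w l c) = t a b c"
proof -
  obtain u :: "nat \<Rightarrow> 'a \<Rightarrow> complex" and v w where
    uvw: "\<forall>a\<in>A. \<forall>b\<in>B. \<forall>c\<in>C. (\<Sum>l<r. u l a * v l b * w l c) = t a b c"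
    using r unfolding rank3_le_def by blast
  obtain g where g: "bij_betw g L {..<card L}"
    using ex_bij_betw_finite_nat[OF L(1)] by (auto simp: atLeast0LessThan)
  define u' where "u' = (\<lambda>l a. if l < r then u l a else 0)"
  have "(\<Sum>l\<in>L. u' (g l) a * v (g l) b * w (g l) c) = t a b c"
    if "a \<in> A" "b \<in> B" "c \<in> C" for a b c
  proof -
    have "(\<Sum>l\<in>L. u' (g l) a * v (g l) b * w (g l) c) = (\<Sum>l<card L. u' l a * v l b * w l c)"
      by (rule sum.reindex_bij_betw[OF g])
    also have "\<dots> = (\<Sum>l<r. u l a * v l b * w l c)"
      using L(2) by (intro sum.mono_neutral_cong_right) (auto simp: u'_def)
    finally show ?thesis using uvw that by simp
  qed
  then show ?thesis by (rule that)
qed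

lemma rank3_le_pullback:
  assumes "rank3_le r A B C t"
    and "\<And>a. a \<in> A' \<Longrightarrow> f a \<in> A" "\<And>b. b \<in> B' \<Longrightarrow> g b \<in> B" "\<And>c. c \<in> C' \<Longrightarrow> h c \<in> C"
    and "\<And>a b c. a \<in> A' \<Longrightarrow> b \<in> B' \<Longrightarrow> c \<in> C' \<Longrightarrow> t (f a) (g b) (h c) = t' a b c"
  shows "rank3_le r A' B' C' t'"
proof -
  obtain u :: "nat \<Rightarrow> 'a \<Rightarrow> complex" and v w where
    "\<forall>a\<in>A. \<forall>b\<in>B. \<forall>c\<in>C. (\<Sum>l<r. u l a * v l b * w l c) = t a b c"
    using assms(1) unfolding rank3_le_def by blast
  then show ?thesis
    using assms(2-) unfolding rank3_le_def
    by (intro exI[of _ "\<lambda>l a. u l (f a)"] exI[of _ "\<lambda>l b. v l (g b)"] exI[of _ "\<lambda>l c. w l (h c)"]) simp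
qed

lemma rank3_le_power:
  assumes "rank3_le r A B C t" "finite P"
  shows "rank3_le (r ^ card P) (P \<rightarrow> A) (P \<rightarrow> B) (P \<rightarrow> C) (\<lambda>a b c. \<Prod>p\<in>P. t (a p) (b p) (c p))"
proof -
  obtain u :: "nat \<Rightarrow> 'a \<Rightarrow> complex" and v w where
    uvw: "\<forall>a\<in>A. \<forall>b\<in>B. \<forall>c\<in>C. (\<Sum>l<r. u l a * v l b * w l c) = t a b c"
    using assms(1) unfolding rank3_le_def by blast
  show ?thesis
  proof (rule rank3_leI[where L = "P \<rightarrow>\<^sub>E {..<r}" and u = "\<lambda>l a. \<Prod>p\<in>P. u (l p) (a p)"
        and v = "\<lambda>l b. \<Prod>p\<in>P. v (l p) (b p)" and w = "\<lambda>l c. \<Prod>p\<in>P. w (l p) (c p)"])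
    fix a b c assume abc: "a \<in> P \<rightarrow> A" "b \<in> P \<rightarrow> B" "c \<in> P \<rightarrow> C"
    have "(\<Prod>p\<in>P. t (a p) (b p) (c p)) = (\<Prod>p\<in>P. \<Sum>l<r. u l (a p) * v l (b p) * w l (c p))"
      using abc uvw by (intro prod.cong) (auto simp: Pi_iff)
    also have "\<dots> = (\<Sum>l\<in>P \<rightarrow>\<^sub>E {..<r}. \<Prod>p\<in>P. u (l p) (a p) * v (l p) (b p) * w (l p) (c p))"
      using assms(2) by (intro prod_sum_PiE) auto
    finally show "(\<Sum>l\<in>P \<rightarrow>\<^sub>E {..<r}. (\<Prod>p\<in>P. u (l p) (a p)) * (\<Prod>p\<in>P. v (l p) (b p))
        * (\<Prod>p\<in>P. w (l p) (c p))) = (\<Prod>p\<in>P. t (a p) (b p) (c p))"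
      by (simp add: prod.distrib)
  qed (use assms(2) in \<open>auto simp: card_funcsetE intro: finite_PiE\<close>)
qed

section \<open>Disjoint copies of matrix multiplication\<close>

text \<open>
  The direct sum of copies of the tensor
  \<open>\<Sum> e(i, j) \<otimes> e(i', j) \<otimes> e(i, i')\<close>, which is
  \<open>multiEMaMu\<close> for \<open>d = 2\<close>.  The first entry of a label is the
  number of the copy.
\<close>
definition matmul_copies :: "nat \<times> nat \<times> nat \<Rightarrow> nat \<times> nat \<times> nat \<Rightarrow> nat \<times> nat \<times> nat \<Rightarrow> complex" where
  "matmul_copies = (\<lambda>(c, i, j) (c', i', j') (c'', k, k').
     of_bool (c = c' \<and> c' = c'' \<and> j = j' \<and> i = k \<and> i' = k'))"

definition matmul_copies_rank_le :: "nat \<Rightarrow> nat \<Rightarrow> nat \<Rightarrow> nat \<Rightarrow> bool" where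
  "matmul_copies_rank_le s a m r \<longleftrightarrow>
     rank3_le r ({..<s} \<times> {..<a} \<times> {..<m}) ({..<s} \<times> {..<a} \<times> {..<m}) ({..<s} \<times> {..<a} \<times> {..<a})
       matmul_copies"

lemma matmul_copies_rank_le_mono:
  assumes "matmul_copies_rank_le s a m r" "s' \<le> s" "a' \<le> a" "m' \<le> m"
  shows "matmul_copies_rank_le s' a' m' r"
  using assms(1) unfolding matmul_copies_rank_le_def
  by (rule rank3_le_pullback[where f = id and g = id and h = id]) (use assms(2-) in auto)

lemma matmul_copies_rank_le_trivial: "matmul_copies_rank_le s 1 1 s"
  unfolding matmul_copies_rank_le_def
proof (rule rank3_leI[where L = "{..<s}" and u = "\<lambda>l (c, i, j). of_bool (c = l)"
      and v = "\<lambda>l (c, i, j). of_bool (c = l)" and w = "\<lambda>l (c, i, j). of_bool (c = l)"])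
  fix x y z :: "nat \<times> nat \<times> nat"
  assume "x \<in> {..<s} \<times> {..<1} \<times> {..<1}" "y \<in> {..<s} \<times> {..<1} \<times> {..<1}"
    "z \<in> {..<s} \<times> {..<1} \<times> {..<1}"
  then obtain c c' c'' where xyz: "x = (c, 0, 0)" "y = (c', 0, 0)" "z = (c'', 0, 0)" "c < s" by auto
  have "(\<Sum>l<s. of_bool (c = l) * of_bool (c' = l) * of_bool (c'' = l))
     = (\<Sum>l<s. if l = c then of_bool (c' = l) * of_bool (c'' = l) else (0 :: complex))"
    by (intro sum.cong) auto
  also have "\<dots> = of_bool (c' = c) * of_bool (c'' = c)"
    using xyz(4) by (subst sum.delta) auto
  finally show "(\<Sum>l<s. (case x of (c, i, j) \<Rightarrow> of_bool (c = l)) * (case y of (c, i, j) \<Rightarrow> of_bool (c = l))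
      * (case z of (c, i, j) \<Rightarrow> of_bool (c = l))) = matmul_copies x y z"
    by (auto simp: xyz matmul_copies_def)
qed auto

text \<open>
  Every unit of a rank decomposition is replaced by a block of a second tensor.  For fixed
  \<open>g\<close>, the factors \<open>x'\<close>, \<open>y'\<close>,
  \<open>z'\<close> describe \<open>s\<close> disjoint copies of one entry
  \<open>\<tau>\<close>; expanding the three sums over the copies leaves the diagonal, so they act like
  \<open>s\<close> rank one terms at once.
\<close>
lemma sum_diagonal_substitute:
  fixes x y z :: "'g \<Rightarrow> nat \<Rightarrow> complex"
  assumes "\<And>b b' b''. b < s \<Longrightarrow> b' < s \<Longrightarrow> b'' < s \<Longrightarrow>
      (\<Sum>l\<in>L. x' l b * y' l b' * z' l b'') = of_bool (b = b' \<and> b' = b'') * \<tau>"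
  shows "(\<Sum>(g, l)\<in>G \<times> L. (\<Sum>b<s. x g b * x' l b) * (\<Sum>b<s. y g b * y' l b) * (\<Sum>b<s. z g b * z' l b))
       = (\<Sum>(g, b)\<in>G \<times> {..<s}. x g b * y g b * z g b) * \<tau>"
proof -
  have expand: "(\<Sum>b<s. \<alpha> b) * (\<Sum>b<s. \<beta> b) * (\<Sum>b<s. \<gamma> b)
      = (\<Sum>b<s. \<Sum>b'<s. \<Sum>b''<s. \<alpha> b * \<beta> b' * \<gamma> b'')" for \<alpha> \<beta> \<gamma> :: "nat \<Rightarrow> complex"
    by (simp only: mult.assoc sum_distrib_right, simp only: sum_distrib_left)
  have "(\<Sum>l\<in>L. (\<Sum>b<s. x g b * x' l b) * (\<Sum>b<s. y g b * y' l b) * (\<Sum>b<s. z g b * z' l b))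
      = (\<Sum>b<s. x g b * y g b * z g b) * \<tau>" for g
  proof -
    have "(\<Sum>l\<in>L. (\<Sum>b<s. x g b * x' l b) * (\<Sum>b<s. y g b * y' l b) * (\<Sum>b<s. z g b * z' l b))
        = (\<Sum>l\<in>L. \<Sum>b<s. \<Sum>b'<s. \<Sum>b''<s.
             (x g b * y g b' * z g b'') * (x' l b * y' l b' * z' l b''))"
      unfolding expand by (simp add: mult_ac)
    also have "\<dots> = (\<Sum>b<s. \<Sum>b'<s. \<Sum>b''<s. \<Sum>l\<in>L.
             (x g b * y g b' * z g b'') * (x' l b * y' l b' * z' l b''))"
      by (subst sum.swap, intro sum.cong refl, subst sum.swap, intro sum.cong refl, rule sum.swap)
    also have "\<dots> = (\<Sum>b<s. \<Sum>b'<s. \<Sum>b''<s.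
             (x g b * y g b' * z g b'') * (of_bool (b = b' \<and> b' = b'') * \<tau>))"
      using assms by (intro sum.cong refl) (simp flip: sum_distrib_left)
    also have "\<dots> = (\<Sum>b<s. \<Sum>b'<s. if b' = b then (x g b * y g b * z g b) * \<tau> else 0)"
    proof (intro sum.cong refl)
      fix b b' assume b: "b \<in> {..<s}" "b' \<in> {..<s}"
      have "(\<Sum>b''<s. (x g b * y g b' * z g b'') * (of_bool (b = b' \<and> b' = b'') * \<tau>))
         = (\<Sum>b''<s. if b'' = b' then of_bool (b = b') * ((x g b * y g b' * z g b') * \<tau>) else 0)"
        by (intro sum.cong) auto
      also have "\<dots> = (if b' = b then (x g b * y g b * z g b) * \<tau> else 0)"
        using b by (subst sum.delta) auto
      finally show "(\<Sum>b''<s. (x g b * y g b' * z g b'') * (of_bool (b = b' \<and> b' = b'') * \<tau>))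
         = (if b' = b then (x g b * y g b * z g b) * \<tau> else 0)" .
    qed
    also have "\<dots> = (\<Sum>b<s. x g b * y g b * z g b) * \<tau>"
      by (simp add: sum_distrib_right)
    finally show ?thesis .
  qed
  then show ?thesis by (simp add: sum.cartesian_product[symmetric] sum_distrib_right)
qed

lemma eq_iff_div_mod_eq: "(i::nat) = k \<longleftrightarrow> i div a = k div a \<and> i mod a = k mod a"
  by (metis div_mult_mod_eq)

text \<open>
  The step that turns many disjoint copies into a saving.  If \<open>s\<close> copies of
  \<open>T\<close> have rank \<open>r\<close>, then \<open>s\<close> copies of
  \<open>T \<boxtimes> T'\<close> are a restriction of \<open>r\<close> copies of
  \<open>T'\<close>, and these can be grouped into \<open>q\<close> batches of
  \<open>s\<close>.  So a factor \<open>T\<close> costs only the quotient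
  \<open>q\<close>, instead of \<open>r\<close>.
\<close>
lemma matmul_copies_substitute:
  assumes t: "matmul_copies_rank_le s a m r" and r: "r \<le> s * q"
    and t': "matmul_copies_rank_le s a' m' r'"
  shows "matmul_copies_rank_le s (a * a') (m * m') (q * r')"
proof -
  obtain u v w where uvw: "\<And>x y z. x \<in> {..<s} \<times> {..<a} \<times> {..<m} \<Longrightarrow>
      y \<in> {..<s} \<times> {..<a} \<times> {..<m} \<Longrightarrow> z \<in> {..<s} \<times> {..<a} \<times> {..<a} \<Longrightarrow>
      (\<Sum>l\<in>{..<q} \<times> {..<s}. u l x * v l y * w l z) = matmul_copies x y z"
    using rank3_leE[OF t[unfolded matmul_copies_rank_le_def], of "{..<q} \<times> {..<s}"] r
    by (auto simp: mult.commute)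
  obtain u' v' w' where uvw': "\<And>x y z. x \<in> {..<s} \<times> {..<a'} \<times> {..<m'} \<Longrightarrow>
      y \<in> {..<s} \<times> {..<a'} \<times> {..<m'} \<Longrightarrow> z \<in> {..<s} \<times> {..<a'} \<times> {..<a'} \<Longrightarrow>
      (\<Sum>l<r'. u' l x * v' l y * w' l z) = matmul_copies x y z"
    using rank3_leE[OF t'[unfolded matmul_copies_rank_le_def], of "{..<r'}"] by auto
  (* The pair (g, b) numbers the rank one terms of T: batch g, place b in the batch.  An index of the
     Kronecker product is split by div and mod into an index of T and one of T'. *)
  define U where "U u u' m m' = (\<lambda>(g, l) (c, i, j).
    \<Sum>b<s. u (g, b) (c, i div a', j div m') * u' l (b, i mod a', j mod m'))"
    for u :: "nat \<times> nat \<Rightarrow> nat \<times> nat \<times> nat \<Rightarrow> complex" and u' :: "nat \<Rightarrow> nat \<times> nat \<times> nat \<Rightarrow> complex"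
      and m m' :: nat
  show ?thesis unfolding matmul_copies_rank_le_def
  proof (rule rank3_leI[where L = "{..<q} \<times> {..<r'}" and u = "U u u' m m'" and v = "U v v' m m'"
        and w = "U w w' a a'"])
    fix x y z assume *: "x \<in> {..<s} \<times> {..<a * a'} \<times> {..<m * m'}"
      "y \<in> {..<s} \<times> {..<a * a'} \<times> {..<m * m'}" "z \<in> {..<s} \<times> {..<a * a'} \<times> {..<a * a'}"
    then obtain c i j c' i' j' c'' k k' where
      xyz: "x = (c, i, j)" "y = (c', i', j')" "z = (c'', k, k')"
      "c < s" "c' < s" "c'' < s" "i < a * a'" "i' < a * a'" "k < a * a'" "k' < a * a'"
      "j < m * m'" "j' < m * m'" by auto
    then have pos: "0 < a'" "0 < m'" by (auto intro: gr0I)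
    define \<tau> :: complex where
      "\<tau> = of_bool (j mod m' = j' mod m' \<and> i mod a' = k mod a' \<and> i' mod a' = k' mod a')"
    have tau: "(\<Sum>l<r'. u' l (b, i mod a', j mod m') * v' l (b', i' mod a', j' mod m')
        * w' l (b'', k mod a', k' mod a')) = of_bool (b = b' \<and> b' = b'') * \<tau>"
      if "b < s" "b' < s" "b'' < s" for b b' b''
      using that pos by (subst uvw') (auto simp: matmul_copies_def \<tau>_def)
    have "(\<Sum>l\<in>{..<q} \<times> {..<r'}. U u u' m m' l x * U v v' m m' l y * U w w' a a' l z)
       = (\<Sum>(g, b)\<in>{..<q} \<times> {..<s}. u (g, b) (c, i div a', j div m') * v (g, b) (c', i' div a', j' div m')
            * w (g, b) (c'', k div a', k' div a')) * \<tau>"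
      unfolding xyz(1-3) U_def by (subst sum_diagonal_substitute[OF tau, symmetric])
        (auto simp: case_prod_beta)
    also have "(\<Sum>(g, b)\<in>{..<q} \<times> {..<s}. u (g, b) (c, i div a', j div m')
          * v (g, b) (c', i' div a', j' div m') * w (g, b) (c'', k div a', k' div a'))
       = matmul_copies (c, i div a', j div m') (c', i' div a', j' div m') (c'', k div a', k' div a')"
      using uvw[of "(c, i div a', j div m')" "(c', i' div a', j' div m')" "(c'', k div a', k' div a')"] xyz
      by (auto simp: case_prod_beta less_mult_imp_div_less)
    also have "\<dots> * \<tau> = matmul_copies x y z"
      unfolding xyz(1-3) matmul_copies_def \<tau>_def
      using eq_iff_div_mod_eq[of j j' m'] eq_iff_div_mod_eq[of i k a'] eq_iff_div_mod_eq[of i' k' a']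
      by auto
    finally show "(\<Sum>l\<in>{..<q} \<times> {..<r'}. U u u' m m' l x * U v v' m m' l y * U w w' a a' l z)
        = matmul_copies x y z" .
  qed auto
qed

lemma matmul_copies_power:
  assumes "matmul_copies_rank_le s a m r" "r \<le> s * q"
  shows "matmul_copies_rank_le s (a ^ K) (m ^ K) (s * q ^ K)"
proof (induction K)
  case 0
  then show ?case using matmul_copies_rank_le_trivial[of s] by simp
next
  case (Suc K)
  from matmul_copies_substitute[OF assms Suc] show ?case by (simp add: mult_ac)
qed

text \<open>
  The Kronecker product with an edge of weight \<open>m'\<close> between the first two factors, which
  costs at most its weight.
\<close>
lemma matmul_copies_widen:
  assumes "matmul_copies_rank_le s a m r"
  shows "matmul_copies_rank_le s a (m * m') (r * m')"
proof -
  obtain u v w where uvw: "\<And>x y z. x \<in> {..<s} \<times> {..<a} \<times> {..<m} \<Longrightarrow>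
      y \<in> {..<s} \<times> {..<a} \<times> {..<m} \<Longrightarrow> z \<in> {..<s} \<times> {..<a} \<times> {..<a} \<Longrightarrow>
      (\<Sum>l<r. u l x * v l y * w l z) = matmul_copies x y z"
    using rank3_leE[OF assms[unfolded matmul_copies_rank_le_def], of "{..<r}"] by auto
  define U where "U u = (\<lambda>(l, h) (c, i, j). u l (c, i, j div m') * of_bool (j mod m' = h))"
    for u :: "nat \<Rightarrow> nat \<times> nat \<times> nat \<Rightarrow> complex"
  show ?thesis unfolding matmul_copies_rank_le_def
  proof (rule rank3_leI[where L = "{..<r} \<times> {..<m'}" and u = "U u" and v = "U v"
        and w = "\<lambda>(l, h). w l"])
    fix x y z assume *: "x \<in> {..<s} \<times> {..<a} \<times> {..<m * m'}"
      "y \<in> {..<s} \<times> {..<a} \<times> {..<m * m'}" "z \<in> {..<s} \<times> {..<a} \<times> {..<a}"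
    then obtain c i j c' i' j' c'' k k' where
      xyz: "x = (c, i, j)" "y = (c', i', j')" "z = (c'', k, k')"
      "c < s" "c' < s" "c'' < s" "i < a" "i' < a" "k < a" "k' < a"
      "j < m * m'" "j' < m * m'" by auto
    then have pos: "0 < m'" by (auto intro: gr0I)
    have "(\<Sum>(l, h)\<in>{..<r} \<times> {..<m'}. U u (l, h) x * U v (l, h) y * w l z)
       = (\<Sum>l<r. \<Sum>h<m'. if h = j mod m' then u l (c, i, j div m') * v l (c', i', j' div m') * w l z
             * of_bool (j mod m' = j' mod m') else 0)"
      unfolding sum.cartesian_product[symmetric] by (intro sum.cong) (auto simp: U_def xyz)
    also have "\<dots> = (\<Sum>l<r. u l (c, i, j div m') * v l (c', i', j' div m') * w l z)
             * of_bool (j mod m' = j' mod m')"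
      using pos by (simp add: sum_distrib_right)
    also have "(\<Sum>l<r. u l (c, i, j div m') * v l (c', i', j' div m') * w l z)
       = matmul_copies (c, i, j div m') (c', i', j' div m') z"
      using xyz by (intro uvw) (auto simp: less_mult_imp_div_less)
    also have "\<dots> * of_bool (j mod m' = j' mod m') = matmul_copies x y z"
      unfolding xyz(1-3) matmul_copies_def using eq_iff_div_mod_eq[of j j' m'] by auto
    finally show "(\<Sum>l\<in>{..<r} \<times> {..<m'}. U u l x * U v l y * (case l of (l, h) \<Rightarrow> w l) z)
        = matmul_copies x y z" by (simp add: case_prod_beta)
  qed auto
qed

section \<open>Schoenhage's tensor and its powers\<close>

text \<open>
  Label \<open>Inl\<close> in the first two factors and \<open>Some\<close> in the third
  belong to the block \<open>A = \<Sum> x i \<otimes> y j \<otimes> w (i, j)\<close>, the others to the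
  block \<open>B = \<Sum> u (i, j) \<otimes> v (i, j) \<otimes> z\<close>.  The tensor below has the
  slices \<open>\<Sum> u (i, j) \<otimes> v (i, j)\<close> at \<open>z\<close> and
  \<open>(x i + u (i, j)) \<otimes> (y j + v (i, j))\<close> at \<open>w (i, j)\<close>.  So it is
  \<open>A + B\<close> plus terms that mix labels of the two blocks, all of which have third label
  \<open>w (i, j)\<close>.  It is what a variant of Schoenhage's border rank decomposition gives when
  the degeneration parameter is set to 1.
\<close>
fun schoenhage :: "nat + nat \<times> nat \<Rightarrow> nat + nat \<times> nat \<Rightarrow> (nat \<times> nat) option \<Rightarrow> complex" where
  "schoenhage a b None = of_bool (\<exists>ij. a = Inr ij \<and> b = Inr ij)"
| "schoenhage a b (Some (i, j)) = of_bool (a \<in> {Inl i, Inr (i, j)} \<and> b \<in> {Inl j, Inr (i, j)})"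

lemma sum_of_bool_point:
  assumes "finite A" "x \<in> A" "\<And>y. y \<in> A \<Longrightarrow> P y \<longleftrightarrow> y = x \<and> Q"
  shows "(\<Sum>y\<in>A. of_bool (P y)) = (of_bool Q :: complex)"
proof -
  have "(\<Sum>y\<in>A. of_bool (P y)) = (\<Sum>y\<in>A. if y = x then of_bool Q else (0 :: complex))"
    using assms(3) by (intro sum.cong) auto
  then show ?thesis using assms(1,2) by simp
qed

text \<open>
  The \<open>n^2\<close> products \<open>(x i + u (i, j)) (y j + v (i, j)) (z + w (i, j))\<close>
  yield all slices at \<open>w (i, j)\<close>.  In the slice at \<open>z\<close> they leave, besides
  \<open>B\<close>, the sum of all \<open>x i y j\<close>, \<open>u (i, j) y j\<close> and
  \<open>x i v (i, j)\<close>.  The terms containing \<open>y j\<close>, for each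
  \<open>j\<close>, are one product, and so are the terms \<open>x i v (i, j)\<close> for each
  \<open>i\<close>: removing them takes \<open>2 * n\<close> more products.
\<close>
lemma rank_schoenhage:
  fixes n :: nat
  defines "A \<equiv> {..<n} <+> {..<n} \<times> {..<n}"
  shows "rank3_le (n ^ 2 + 2 * n) A A (insert None (Some ` ({..<n} \<times> {..<n}))) schoenhage"
proof -
  define L where "L = ({..<n} \<times> {..<n}) <+> ({..<n} <+> {..<n})"
  define u :: "(nat \<times> nat) + (nat + nat) \<Rightarrow> nat + nat \<times> nat \<Rightarrow> complex" where
    "u = (\<lambda>l a. case l of
        Inl (i, j) \<Rightarrow> of_bool (a = Inl i \<or> a = Inr (i, j))
      | Inr (Inl j) \<Rightarrow> of_bool (case a of Inl _ \<Rightarrow> True | Inr (i', j') \<Rightarrow> j' = j)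
      | Inr (Inr i) \<Rightarrow> of_bool (a = Inl i))"
  define v :: "(nat \<times> nat) + (nat + nat) \<Rightarrow> nat + nat \<times> nat \<Rightarrow> complex" where
    "v = (\<lambda>l b. case l of
        Inl (i, j) \<Rightarrow> of_bool (b = Inl j \<or> b = Inr (i, j))
      | Inr (Inl j) \<Rightarrow> of_bool (b = Inl j)
      | Inr (Inr i) \<Rightarrow> of_bool (case b of Inl _ \<Rightarrow> False | Inr (i', j') \<Rightarrow> i' = i))"
  define w :: "(nat \<times> nat) + (nat + nat) \<Rightarrow> (nat \<times> nat) option \<Rightarrow> complex" where
    "w = (\<lambda>l c. case l of
        Inl ij \<Rightarrow> of_bool (c = None \<or> c = Some ij)
      | Inr _ \<Rightarrow> - of_bool (c = None))"
  note uvw = u_def v_def w_def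
  have split: "(\<Sum>l\<in>L. u l a * v l b * w l c)
      = (\<Sum>ij\<in>{..<n} \<times> {..<n}. u (Inl ij) a * v (Inl ij) b * w (Inl ij) c)
      + ((\<Sum>j<n. u (Inr (Inl j)) a * v (Inr (Inl j)) b * w (Inr (Inl j)) c)
         + (\<Sum>i<n. u (Inr (Inr i)) a * v (Inr (Inr i)) b * w (Inr (Inr i)) c))" for a b c
    unfolding L_def by (simp add: sum.Plus)
  show ?thesis
  proof (rule rank3_leI[where L = L and u = u and v = v and w = w])
    fix a b c assume abc: "a \<in> A" "b \<in> A" "c \<in> insert None (Some ` ({..<n} \<times> {..<n}))"
    show "(\<Sum>l\<in>L. u l a * v l b * w l c) = schoenhage a b c"
    proof (cases c)
      case (Some ij)
      obtain i j where ij: "ij = (i, j)" by force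
      have "(\<Sum>l\<in>L. u l a * v l b * w l c) = (\<Sum>ij\<in>{..<n} \<times> {..<n}. of_bool
          (ij = (i, j) \<and> a \<in> {Inl i, Inr (i, j)} \<and> b \<in> {Inl j, Inr (i, j)}))"
      proof -
        have "u (Inl p) a * v (Inl p) b * w (Inl p) c
            = of_bool (p = (i, j) \<and> a \<in> {Inl i, Inr (i, j)} \<and> b \<in> {Inl j, Inr (i, j)})" for p
          by (cases p) (auto simp: uvw Some ij)
        moreover have "w (Inr p) c = 0" for p by (simp add: w_def Some)
        ultimately show ?thesis unfolding split by (simp only: mult_zero_right sum.neutral_const add_0_right)
      qed
      also have "\<dots> = schoenhage a b c"
        unfolding Some ij schoenhage.simps using abc(3) Some ij
        by (intro sum_of_bool_point[of _ "(i, j)"]) auto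
      finally show ?thesis .
    next
      case None
      define P where "P = (\<lambda>(i, j). (a = Inl i \<or> a = Inr (i, j)) \<and> (b = Inl j \<or> b = Inr (i, j)))"
      define Q where "Q j \<longleftrightarrow> (case a of Inl _ \<Rightarrow> True | Inr (i', j') \<Rightarrow> j' = j) \<and> b = Inl j" for j
      define R where "R i \<longleftrightarrow> a = Inl i \<and> (case b of Inl _ \<Rightarrow> False | Inr (i', j') \<Rightarrow> i' = i)" for i
      have eq: "(\<Sum>l\<in>L. u l a * v l b * w l c) = (\<Sum>ij\<in>{..<n} \<times> {..<n}. of_bool (P ij))
          - (\<Sum>j<n. of_bool (Q j)) - (\<Sum>i<n. of_bool (R i))"
        unfolding split None P_def Q_def R_def
        by (simp add: uvw case_prod_beta sum_negf flip: of_bool_conj)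
      show ?thesis
      proof (cases a; cases b)
        fix \<alpha> \<beta> assume *: "a = Inl \<alpha>" "b = Inl \<beta>"
        have "(\<Sum>ij\<in>{..<n} \<times> {..<n}. of_bool (P ij)) = (of_bool True :: complex)"
          using * abc by (intro sum_of_bool_point[of _ "(\<alpha>, \<beta>)"]) (auto simp: P_def A_def)
        moreover have "(\<Sum>j<n. of_bool (Q j)) = (of_bool True :: complex)"
          using * abc by (intro sum_of_bool_point[of _ \<beta>]) (auto simp: Q_def A_def)
        ultimately show ?thesis unfolding eq using * None by (simp add: R_def)
      next
        fix \<alpha> \<beta> assume *: "a = Inl \<alpha>" "b = Inr \<beta>"
        have "(\<Sum>ij\<in>{..<n} \<times> {..<n}. of_bool (P ij)) = (of_bool (fst \<beta> = \<alpha>) :: complex)"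
          using * abc by (intro sum_of_bool_point[of _ \<beta>]) (auto simp: P_def A_def)
        moreover have "(\<Sum>i<n. of_bool (R i)) = (of_bool (fst \<beta> = \<alpha>) :: complex)"
          using * abc by (intro sum_of_bool_point[of _ \<alpha>]) (auto simp: R_def A_def)
        ultimately show ?thesis unfolding eq using * None by (simp add: Q_def)
      next
        fix \<alpha> \<beta> assume *: "a = Inr \<alpha>" "b = Inl \<beta>"
        have "(\<Sum>ij\<in>{..<n} \<times> {..<n}. of_bool (P ij)) = (of_bool (snd \<alpha> = \<beta>) :: complex)"
          using * abc by (intro sum_of_bool_point[of _ \<alpha>]) (auto simp: P_def A_def)
        moreover have "(\<Sum>j<n. of_bool (Q j)) = (of_bool (snd \<alpha> = \<beta>) :: complex)"
          using * abc by (intro sum_of_bool_point[of _ \<beta>]) (auto simp: Q_def A_def)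
        ultimately show ?thesis unfolding eq using * None by (simp add: R_def)
      next
        fix \<alpha> \<beta> assume *: "a = Inr \<alpha>" "b = Inr \<beta>"
        have "(\<Sum>ij\<in>{..<n} \<times> {..<n}. of_bool (P ij)) = (of_bool (\<alpha> = \<beta>) :: complex)"
          using * abc by (intro sum_of_bool_point[of _ \<alpha>]) (auto simp: P_def A_def)
        then show ?thesis unfolding eq using * None by (simp add: Q_def R_def)
      qed
    qed
  next
    show "card L \<le> n ^ 2 + 2 * n" by (simp add: L_def card_Plus power2_eq_square)
  qed (simp add: L_def)
qed

text \<open>
  In the \<open>N\<close>-th power, the words whose set \<open>W\<close> of positions with a label
  of block \<open>A\<close> has \<open>k\<close> elements carry one copy of
  \<open>A^k \<boxtimes> B^(N - k)\<close> for each \<open>W\<close>.  The mixed terms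
  of \<open>schoenhage\<close> disappear: an entry with sets \<open>W\<close>,
  \<open>W'\<close>, \<open>W''\<close> in the three factors can only be nonzero if
  \<open>W \<union> W' \<subseteq> W''\<close>, and since the three sets have equal size they coincide.
  Fixing the size thus replaces the passage to the limit, and the bound holds for the rank itself.
\<close>
lemma matmul_copies_schoenhage:
  assumes "k \<le> N"
  shows "matmul_copies_rank_le (N choose k) (n ^ k) ((n ^ 2) ^ (N - k)) ((n ^ 2 + 2 * n) ^ N)"
proof -
  define \<W> where "\<W> = {W. W \<subseteq> {..<N} \<and> card W = k}"
  have \<W>: "finite \<W>" "card \<W> = N choose k" by (auto simp: \<W>_def n_subsets)
  obtain pos where pos: "inj_on pos {..<N choose k}" "pos ` {..<N choose k} \<subseteq> \<W>"
    using card_le_inj[of "{..<N choose k}" \<W>] \<W> by auto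
  have W: "pos c \<subseteq> {..<N}" "card (pos c) = k" "finite (pos c)" if "c < N choose k" for c
    using that pos(2) by (auto simp: \<W>_def intro: finite_subset)
  have "\<exists>f. f ` {..<n ^ k} \<subseteq> (pos c \<rightarrow>\<^sub>E {..<n}) \<and> inj_on f {..<n ^ k}" if "c < N choose k" for c
    using W[OF that] by (intro card_le_inj) (auto simp: card_funcsetE intro: finite_PiE)
  then obtain f where f: "\<And>c. c < N choose k \<Longrightarrow> f c ` {..<n ^ k} \<subseteq> (pos c \<rightarrow>\<^sub>E {..<n})"
    "\<And>c. c < N choose k \<Longrightarrow> inj_on (f c) {..<n ^ k}" by metis
  have "\<exists>g. g ` {..<(n ^ 2) ^ (N - k)} \<subseteq> ({..<N} - pos c \<rightarrow>\<^sub>E {..<n} \<times> {..<n})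
      \<and> inj_on g {..<(n ^ 2) ^ (N - k)}" if "c < N choose k" for c
    using W[OF that] by (intro card_le_inj)
      (auto simp: card_funcsetE card_Diff_subset power2_eq_square intro!: finite_PiE)
  then obtain g where g: "\<And>c. c < N choose k \<Longrightarrow>
      g c ` {..<(n ^ 2) ^ (N - k)} \<subseteq> ({..<N} - pos c \<rightarrow>\<^sub>E {..<n} \<times> {..<n})"
    "\<And>c. c < N choose k \<Longrightarrow> inj_on (g c) {..<(n ^ 2) ^ (N - k)}" by metis
  (* A label (c, i, j) is sent to a word: pos c is its set of A-positions, f c i lists the letters
     there, and g c j lists the letters at the other positions. *)
  define F where "F = (\<lambda>(c, i, j) p. if p \<in> pos c then Inl (f c i p) else Inr (g c j p))"
  define H where "H = (\<lambda>(c, i, j) p. if p \<in> pos c then Some (f c i p, f c j p) else None)"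
  have fr: "f c i p < n" if "c < N choose k" "i < n ^ k" "p \<in> pos c" for c i p
    using f(1)[OF that(1)] that(2,3) by (force simp: PiE_iff)
  have gr: "g c j p \<in> {..<n} \<times> {..<n}"
    if "c < N choose k" "j < (n ^ 2) ^ (N - k)" "p \<in> {..<N} - pos c" for c j p
    using g(1)[OF that(1)] that(2,3) by (force simp: PiE_iff)
  have feq: "i = i'" if "c < N choose k" "i < n ^ k" "i' < n ^ k" "\<And>p. p \<in> pos c \<Longrightarrow> f c i p = f c i' p"
    for c i i'
  proof -
    have "f c i = f c i'"
      using f(1)[OF that(1)] that by (intro PiE_ext[of _ "pos c" "\<lambda>_. {..<n}"]) auto
    then show ?thesis using inj_onD[OF f(2)[OF that(1)]] that by auto
  qed
  have geq: "j = j'" if "c < N choose k" "j < (n ^ 2) ^ (N - k)" "j' < (n ^ 2) ^ (N - k)"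
    "\<And>p. p \<in> {..<N} - pos c \<Longrightarrow> g c j p = g c j' p" for c j j'
  proof -
    have "g c j = g c j'"
      using g(1)[OF that(1)] that
      by (intro PiE_ext[of _ "{..<N} - pos c" "\<lambda>_. {..<n} \<times> {..<n}"]) auto
    then show ?thesis using inj_onD[OF g(2)[OF that(1)]] that by auto
  qed
  let ?A = "{..<n} <+> {..<n} \<times> {..<n}" and ?C = "insert None (Some ` ({..<n} \<times> {..<n}))"
  have "rank3_le ((n ^ 2 + 2 * n) ^ N) ({..<N} \<rightarrow> ?A) ({..<N} \<rightarrow> ?A) ({..<N} \<rightarrow> ?C)
      (\<lambda>a b c. \<Prod>p<N. schoenhage (a p) (b p) (c p))"
    using rank3_le_power[OF rank_schoenhage[of n], of "{..<N}"] by simp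
  then show ?thesis unfolding matmul_copies_rank_le_def
  proof (rule rank3_le_pullback[where f = F and g = F and h = H])
    fix x assume x: "x \<in> {..<N choose k} \<times> {..<n ^ k} \<times> {..<(n ^ 2) ^ (N - k)}"
    then show "F x \<in> {..<N} \<rightarrow> ?A" using fr gr by (auto simp: F_def)
    from x show "F x \<in> {..<N} \<rightarrow> ?A" using fr gr by (auto simp: F_def)
  next
    fix x assume "x \<in> {..<N choose k} \<times> {..<n ^ k} \<times> {..<n ^ k}"
    then show "H x \<in> {..<N} \<rightarrow> ?C" using fr by (auto simp: H_def)
  next
    fix x y z assume *: "x \<in> {..<N choose k} \<times> {..<n ^ k} \<times> {..<(n ^ 2) ^ (N - k)}"
      "y \<in> {..<N choose k} \<times> {..<n ^ k} \<times> {..<(n ^ 2) ^ (N - k)}"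
      "z \<in> {..<N choose k} \<times> {..<n ^ k} \<times> {..<n ^ k}"
    then obtain c i j c' i' j' c'' h h' where
      xyz: "x = (c, i, j)" "y = (c', i', j')" "z = (c'', h, h')" by (metis prod.exhaust)
    note r = *[unfolded xyz, simplified]
    have zero_one: "schoenhage (F x p) (F y p) (H z p) \<in> {0, 1}" for p
      by (cases "H z p") auto
    show "(\<Prod>p<N. schoenhage (F x p) (F y p) (H z p)) = matmul_copies x y z"
    proof (cases "\<forall>p<N. schoenhage (F x p) (F y p) (H z p) \<noteq> 0")
      case False
      then have "(\<Prod>p<N. schoenhage (F x p) (F y p) (H z p)) = 0" by auto
      moreover have "\<not> (c = c' \<and> c' = c'' \<and> j = j' \<and> i = h \<and> i' = h')"
      proof
        assume "c = c' \<and> c' = c'' \<and> j = j' \<and> i = h \<and> i' = h'"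
        then have "schoenhage (F x p) (F y p) (H z p) \<noteq> 0" for p
          by (auto simp: xyz F_def H_def)
        then show False using False by blast
      qed
      then have "matmul_copies x y z = 0" by (simp add: xyz matmul_copies_def)
      ultimately show ?thesis by (simp only:)
    next
      case True
      (* At a position outside pos c'' the third label is z, where only pairs of B-labels occur. *)
      have sub: "pos c \<union> pos c' \<subseteq> pos c''"
      proof
        fix p assume p: "p \<in> pos c \<union> pos c'"
        then have "p < N" using W(1) r by auto
        then show "p \<in> pos c''" using True p
          by (auto simp: xyz F_def H_def split: if_splits)
      qed
      have "pos c = pos c''" "pos c' = pos c''"
        using sub W[of c] W[of c'] W[of c''] r card_subset_eq[of "pos c''"] by simp_all
      then have c: "c = c''" "c' = c''" using inj_onD[OF pos(1)] r by auto
      have "i = h" "i' = h'"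
      proof -
        have "f c i p = f c h p \<and> f c i' p = f c h' p" if "p \<in> pos c" for p
        proof -
          have "p < N" using that W(1) r by auto
          then show ?thesis using True that by (auto simp: xyz F_def H_def c)
        qed
        then show "i = h" "i' = h'" using feq[of c] r by auto
      qed
      moreover have "j = j'"
      proof -
        have "g c j p = g c j' p" if "p \<in> {..<N} - pos c" for p
          using True that by (auto simp: xyz F_def H_def c)
        then show ?thesis using geq[of c] r by auto
      qed
      moreover have "(\<Prod>p<N. schoenhage (F x p) (F y p) (H z p)) = 1"
        using True zero_one by (intro prod.neutral) blast
      ultimately show ?thesis using c by (simp add: xyz matmul_copies_def)
    qed
  qed
qed

section \<open>From matrix multiplication to the tensor of order d + 1\<close>

lemma tensor_rank_le:
  fixes v :: "'l \<Rightarrow> nat \<Rightarrow> 'i \<Rightarrow> complex"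
  assumes L: "finite L"
    and T: "\<And>x. x \<in> multi_indices k I \<Longrightarrow> T x = (\<Sum>l\<in>L. simple_tensor k (v l) x)"
  shows "tensor_rank k I T \<le> card L"
proof -
  obtain g where g: "bij_betw g {..<card L} L"
    using ex_bij_betw_nat_finite[OF L] by (auto simp: atLeast0LessThan)
  have "T x = (\<Sum>s<card L. simple_tensor k (v (g s)) x)" if "x \<in> multi_indices k I" for x
    using T[OF that] sum.reindex_bij_betw[OF g, of "\<lambda>l. simple_tensor k (v l) x"] by simp
  then show ?thesis unfolding tensor_rank_def by (intro Least_le exI[of _ "\<lambda>s. v (g s)"]) blast
qed

lemma border_rank_le_tensor_rank: "border_rank k I T \<le> tensor_rank k I T"
  unfolding border_rank_def by (intro Least_le exI[of _ "\<lambda>_. T"]) auto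

lemma multiEMaMu_coordinates:
  assumes d: "d \<ge> 2" and x: "x \<in> multi_indices (d + 1) (multiEMaMu_labels d a b)"
  shows "multiEMaMu d a b x
    = of_bool (x 1 ! 1 = x 2 ! 1 \<and> (\<forall>q\<in>{1..d}. x q ! 0 = x (d + 1) ! (q - 1)))"
proof -
  have lab: "x q \<in> multiEMaMu_labels d a b q" if "q \<in> {1..d + 1}" for q
    using x that by (auto simp: multi_indices_def)
  have x12: "\<exists>i j. x q = [i, j] \<and> i \<in> {1..a} \<and> j \<in> {1..b}" if "q \<in> {1, 2}" for q
    using lab[of q] that d by (auto simp: multiEMaMu_labels_def)
  have x3: "\<exists>i. x q = [i] \<and> i \<in> {1..a}" if "q \<in> {3..d}" for q
    using lab[of q] that d by (auto simp: multiEMaMu_labels_def)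
  have hub: "length (x (d + 1)) = d"
    using lab[of "d + 1"] d by (auto simp: multiEMaMu_labels_def)
  define i0 where "i0 = (\<lambda>q\<in>{1..d}. x q ! 0)"
  define j0 where "j0 = x 1 ! 1"
  have i0: "i0 \<in> {1..d} \<rightarrow>\<^sub>E {1..a}"
  proof -
    have "x q ! 0 \<in> {1..a}" if "q \<in> {1..d}" for q
      using x12[of q] x3[of q] that by (cases "q \<in> {1, 2}") auto
    then show ?thesis by (auto simp: i0_def)
  qed
  have j0: "j0 \<in> {1..b}" using x12[of 1] by (auto simp: j0_def)
  (* The coordinates of x determine the only summand that can contribute, (i0, j0). *)
  define ok where "ok \<longleftrightarrow> x 1 ! 1 = x 2 ! 1 \<and> (\<forall>q\<in>{1..d}. x q ! 0 = x (d + 1) ! (q - 1))"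
  have coord: "simple_tensor (d + 1) (\<lambda>q. basis_vec (multiEMaMu_label d i j q)) x
      = of_bool (i = i0 \<and> j = j0 \<and> ok)" if i: "i \<in> {1..d} \<rightarrow>\<^sub>E {1..a}" for i j
  proof -
    have "simple_tensor (d + 1) (\<lambda>q. basis_vec (multiEMaMu_label d i j q)) x
        = of_bool (\<forall>q\<in>{1..d + 1}. x q = multiEMaMu_label d i j q)"
    proof (cases "\<forall>q\<in>{1..d + 1}. x q = multiEMaMu_label d i j q")
      case False
      then obtain q where "q \<in> {1..d + 1}" "x q \<noteq> multiEMaMu_label d i j q" by blast
      then have "simple_tensor (d + 1) (\<lambda>q. basis_vec (multiEMaMu_label d i j q)) x = 0"
        unfolding simple_tensor_def basis_vec_def by (intro prod_zero) auto
      then show ?thesis using False by simp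
    qed (simp add: simple_tensor_def basis_vec_def)
    also have "(\<forall>q\<in>{1..d + 1}. x q = multiEMaMu_label d i j q) \<longleftrightarrow> i = i0 \<and> j = j0 \<and> ok"
    proof
      assume eq: "\<forall>q\<in>{1..d + 1}. x q = multiEMaMu_label d i j q"
      have q0: "x q ! 0 = i q" if "q \<in> {1..d}" for q
        using eq[rule_format, of q] that by (auto simp: multiEMaMu_label_def)
      have "x (d + 1) ! (q - 1) = i q" if "q \<in> {1..d}" for q
        using eq[rule_format, of "d + 1"] that d by (auto simp: multiEMaMu_label_def simp del: upt_Suc)
      moreover have "x 1 ! 1 = j" "x 2 ! 1 = j"
        using eq[rule_format, of 1] eq[rule_format, of 2] d by (auto simp: multiEMaMu_label_def)
      moreover have "i = i0"
        using q0 by (intro PiE_ext[OF i i0]) (auto simp: i0_def)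
      ultimately show "i = i0 \<and> j = j0 \<and> ok" using q0 by (auto simp: j0_def ok_def)
    next
      assume *: "i = i0 \<and> j = j0 \<and> ok"
      show "\<forall>q\<in>{1..d + 1}. x q = multiEMaMu_label d i j q"
      proof
        fix q assume q: "q \<in> {1..d + 1}"
        consider "q \<in> {1, 2}" | "q \<in> {3..d}" | "q = d + 1" using q by fastforce
        then show "x q = multiEMaMu_label d i j q"
        proof cases
          case 1
          then have "i q = x q ! 0" "j = x q ! 1"
            using * d by (auto simp: i0_def j0_def ok_def)
          then show ?thesis using x12[OF 1] 1 by (auto simp: multiEMaMu_label_def)
        next
          case 2
          then show ?thesis using x3[of q] *
            by (auto simp: multiEMaMu_label_def i0_def)
        next
          case 3
          have "x (d + 1) = map i [1..<Suc d]"
          proof (rule nth_equalityI)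
            fix p assume "p < length (x (d + 1))"
            then have "p < d" using hub by simp
            then show "x (d + 1) ! p = map i [1..<Suc d] ! p"
              using * by (auto simp: ok_def i0_def simp del: upt_Suc)
          qed (use hub in simp)
          then show ?thesis using 3 d by (simp add: multiEMaMu_label_def)
        qed
      qed
    qed
    finally show ?thesis .
  qed
  have "multiEMaMu d a b x = (\<Sum>i\<in>{1..d} \<rightarrow>\<^sub>E {1..a}. \<Sum>j=1..b. of_bool (i = i0 \<and> j = j0 \<and> ok))"
    unfolding multiEMaMu_def using coord by (intro sum.cong) auto
  also have "\<dots> = (\<Sum>i\<in>{1..d} \<rightarrow>\<^sub>E {1..a}. of_bool (i = i0 \<and> ok))"
    using j0 by (intro sum.cong refl sum_of_bool_point[of _ j0]) auto
  also have "\<dots> = of_bool ok"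
    using i0 by (intro sum_of_bool_point[of _ i0]) (auto intro: finite_PiE)
  finally show ?thesis by (simp add: ok_def)
qed

text \<open>
  The tensor is the Kronecker product of the matrix multiplication tensor on the factors
  \<open>1\<close>, \<open>2\<close>, \<open>d + 1\<close> with an edge of weight
  \<open>a\<close> between \<open>q\<close> and \<open>d + 1\<close> for each
  \<open>q\<close> from \<open>3\<close> to \<open>d\<close>; each of these \<open>d - 2\<close> edges multiplies the rank by at most
  \<open>a\<close>.
\<close>
lemma multiEMaMu_border_rank_le:
  assumes d: "d \<ge> 2" and r: "matmul_copies_rank_le 1 a b r"
  shows "multiEMaMu_border_rank d a b \<le> r * a ^ (d - 2)"
proof -
  obtain u v w where uvw: "\<And>x y z. x \<in> {..<1} \<times> {..<a} \<times> {..<b} \<Longrightarrow>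
      y \<in> {..<1} \<times> {..<a} \<times> {..<b} \<Longrightarrow> z \<in> {..<1} \<times> {..<a} \<times> {..<a} \<Longrightarrow>
      (\<Sum>l<r. u l x * v l y * w l z) = matmul_copies x y z"
    using rank3_leE[OF r[unfolded matmul_copies_rank_le_def], of "{..<r}"] by auto
  define G where "G = {3..d} \<rightarrow>\<^sub>E {1..a}"
  (* The labels of multiEMaMu count from 1, those of matmul_copies from 0; the entries of a list are
     numbered from 0, so the hub stores the index of factor q at position q - 1. *)
  define V :: "nat \<times> (nat \<Rightarrow> nat) \<Rightarrow> nat \<Rightarrow> nat list \<Rightarrow> complex" where
    "V = (\<lambda>(l, g) q y.
       if q = 1 then u l (0, y ! 0 - 1, y ! 1 - 1)
       else if q = 2 then v l (0, y ! 0 - 1, y ! 1 - 1)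
       else if q \<le> d then of_bool (y ! 0 = g q)
       else w l (0, y ! 0 - 1, y ! 1 - 1) * of_bool (\<forall>q\<in>{3..d}. y ! (q - 1) = g q))"
  have "tensor_rank (d + 1) (multiEMaMu_labels d a b) (multiEMaMu d a b) \<le> card ({..<r} \<times> G)"
  proof (rule tensor_rank_le[where v = V])
    show "finite ({..<r} \<times> G)" by (auto simp: G_def intro: finite_PiE)
  next
    fix x assume x: "x \<in> multi_indices (d + 1) (multiEMaMu_labels d a b)"
    have lab: "x q \<in> multiEMaMu_labels d a b q" if "q \<in> {1..d + 1}" for q
      using x that by (auto simp: multi_indices_def)
    obtain i j where x1: "x 1 = [i, j]" "i \<in> {1..a}" "j \<in> {1..b}"
      using lab[of 1] d by (auto simp: multiEMaMu_labels_def)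
    obtain i' j' where x2: "x 2 = [i', j']" "i' \<in> {1..a}" "j' \<in> {1..b}"
      using lab[of 2] d by (auto simp: multiEMaMu_labels_def)
    have x3: "x q ! 0 \<in> {1..a}" if "q \<in> {3..d}" for q
      using lab[of q] that d by (auto simp: multiEMaMu_labels_def)
    have hub: "length (x (d + 1)) = d" "set (x (d + 1)) \<subseteq> {1..a}"
      using lab[of "d + 1"] d by (auto simp: multiEMaMu_labels_def)
    define k where "k p = x (d + 1) ! p" for p
    have k: "k p \<in> {1..a}" if "p < d" for p
      using hub nth_mem[of p "x (d + 1)"] that unfolding k_def by (metis subsetD)
    define g0 where "g0 = (\<lambda>q\<in>{3..d}. x q ! 0)"
    have g0: "g0 \<in> G" using x3 by (auto simp: g0_def G_def)
    have st: "simple_tensor (d + 1) (V (l, g)) x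
       = u l (0, i - 1, j - 1) * v l (0, i' - 1, j' - 1) * w l (0, k 0 - 1, k 1 - 1)
         * of_bool (g = g0 \<and> (\<forall>q\<in>{3..d}. k (q - 1) = x q ! 0))" if g: "g \<in> G" for l g
    proof -
      have range: "{1..d + 1} = insert 1 (insert 2 (insert (d + 1) {3..d}))" using d by auto
      have "simple_tensor (d + 1) (V (l, g)) x
         = u l (0, i - 1, j - 1) * v l (0, i' - 1, j' - 1) * w l (0, k 0 - 1, k 1 - 1)
           * (of_bool (\<forall>q\<in>{3..d}. k (q - 1) = g q) * (\<Prod>q=3..d. V (l, g) q (x q)))"
        unfolding simple_tensor_def range using d x1 x2
        by (simp add: V_def k_def mult_ac)
      also have "(\<Prod>q=3..d. V (l, g) q (x q)) = (\<Prod>q=3..d. of_bool (x q ! 0 = g q))"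
        by (intro prod.cong) (auto simp: V_def)
      also have "\<dots> = of_bool (g = g0)"
      proof (cases "g = g0")
        case False
        then obtain q where "q \<in> {3..d}" "g q \<noteq> g0 q"
          using g g0 unfolding G_def by (meson PiE_ext)
        then have "(\<Prod>q=3..d. of_bool (x q ! 0 = g q)) = (0 :: complex)"
          by (intro prod_zero) (auto simp: g0_def intro!: bexI[of _ q])
        then show ?thesis using False by simp
      qed (simp add: g0_def)
      also have "of_bool (\<forall>q\<in>{3..d}. k (q - 1) = g q) * of_bool (g = g0)
         = (of_bool (g = g0 \<and> (\<forall>q\<in>{3..d}. k (q - 1) = x q ! 0)) :: complex)"
        by (auto simp: g0_def)
      finally show ?thesis .
    qed
    have "(\<Sum>l\<in>{..<r} \<times> G. simple_tensor (d + 1) (V l) x)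
       = (\<Sum>l<r. \<Sum>g\<in>G. u l (0, i - 1, j - 1) * v l (0, i' - 1, j' - 1) * w l (0, k 0 - 1, k 1 - 1)
         * of_bool (g = g0 \<and> (\<forall>q\<in>{3..d}. k (q - 1) = x q ! 0)))"
      using st by (simp add: sum.cartesian_product' cong: sum.cong)
    also have "\<dots> = (\<Sum>l<r. u l (0, i - 1, j - 1) * v l (0, i' - 1, j' - 1) * w l (0, k 0 - 1, k 1 - 1))
         * (\<Sum>g\<in>G. of_bool (g = g0 \<and> (\<forall>q\<in>{3..d}. k (q - 1) = x q ! 0)))"
      by (simp only: sum_product)
    also have "(\<Sum>g\<in>G. of_bool (g = g0 \<and> (\<forall>q\<in>{3..d}. k (q - 1) = x q ! 0)))
        = (of_bool (\<forall>q\<in>{3..d}. k (q - 1) = x q ! 0) :: complex)"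
      using g0 by (intro sum_of_bool_point[of _ g0]) (auto simp: G_def intro: finite_PiE)
    also have "(\<Sum>l<r. u l (0, i - 1, j - 1) * v l (0, i' - 1, j' - 1) * w l (0, k 0 - 1, k 1 - 1))
        = matmul_copies (0, i - 1, j - 1) (0, i' - 1, j' - 1) (0, k 0 - 1, k 1 - 1)"
      using x1 x2 k[of 0] k[of 1] d by (intro uvw) auto
    also have "\<dots> = of_bool (j = j' \<and> i = k 0 \<and> i' = k 1)"
      using x1 x2 k[of 0] k[of 1] d by (auto simp: matmul_copies_def)
    also have "\<dots> * of_bool (\<forall>q\<in>{3..d}. k (q - 1) = x q ! 0) = multiEMaMu d a b x"
    proof -
      have range: "{1..d} = insert 1 (insert 2 {3..d})" using d by auto
      have "(\<forall>q\<in>{3..d}. k (q - 1) = x q ! 0) \<longleftrightarrow> (\<forall>q\<in>{3..d}. x q ! 0 = k (q - 1))" by metis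
      then show ?thesis unfolding multiEMaMu_coordinates[OF d x] range
        using x1 x2 by (auto simp: k_def)
    qed
    finally show "multiEMaMu d a b x = (\<Sum>l\<in>{..<r} \<times> G. simple_tensor (d + 1) (V l) x)" by simp
  qed
  also have "card ({..<r} \<times> G) = r * a ^ (d - 2)"
  proof -
    have "Suc d - 3 = d - 2" by simp
    then show ?thesis by (simp add: G_def card_funcsetE card_cartesian_product)
  qed
  finally show ?thesis
    unfolding multiEMaMu_border_rank_def using border_rank_le_tensor_rank le_trans by blast
qed

text \<open>
  The finite form of the bound.  The \<open>N\<close>-th power of Schoenhage's tensor contains
  \<open>N choose k\<close> copies of \<open>multiEMaMu(2; n^k, n^(2 (N - k)))\<close>,
  and its \<open>K\<close>-th power covers the weights \<open>n^M\<close> and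
  \<open>n^(2 J)\<close>.  The remaining weight \<open>n^((d - 2) J)\<close> of the edge
  \<open>{1, 2}\<close> is paid for in full.
\<close>
lemma multiEMaMu_border_rank_power_le:
  assumes d: "d \<ge> 2" and n: "n > 0" and k: "k \<le> N"
    and K: "M \<le> k * K" "J \<le> (N - k) * K" and b: "b \<le> n ^ (d * J)"
    and q: "(n ^ 2 + 2 * n) ^ N \<le> (N choose k) * q"
  shows "multiEMaMu_border_rank d (n ^ M) b \<le> (N choose k) * q ^ K * n ^ ((d - 2) * (J + M))"
proof -
  have "matmul_copies_rank_le (N choose k) ((n ^ k) ^ K) (((n ^ 2) ^ (N - k)) ^ K) ((N choose k) * q ^ K)"
    using matmul_copies_power[OF matmul_copies_schoenhage[OF k] q] .
  then have "matmul_copies_rank_le (N choose k) ((n ^ k) ^ K) (((n ^ 2) ^ (N - k)) ^ K * n ^ ((d - 2) * J))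
      ((N choose k) * q ^ K * n ^ ((d - 2) * J))"
    by (rule matmul_copies_widen)
  then have "matmul_copies_rank_le 1 (n ^ M) b ((N choose k) * q ^ K * n ^ ((d - 2) * J))"
  proof (rule matmul_copies_rank_le_mono)
    show "1 \<le> N choose k" using k by (simp add: Suc_le_eq)
    show "n ^ M \<le> (n ^ k) ^ K" using n K(1) by (simp add: power_increasing flip: power_mult)
    have "d * J = 2 * J + (d - 2) * J" using d by (simp add: algebra_simps flip: add_mult_distrib)
    then have "b \<le> n ^ (2 * J) * n ^ ((d - 2) * J)" using b by (simp add: power_add)
    also have "n ^ (2 * J) \<le> ((n ^ 2) ^ (N - k)) ^ K"
      using n K(2) by (simp add: power_increasing flip: power_mult)
    finally show "b \<le> ((n ^ 2) ^ (N - k)) ^ K * n ^ ((d - 2) * J)" by simp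
  qed
  from multiEMaMu_border_rank_le[OF d this] show ?thesis
    by (simp add: add_mult_distrib add_mult_distrib2 power_add mult_ac flip: power_mult)
qed

section \<open>Optimising the parameters\<close>

text \<open>
  The binomial distribution has its mode at \<open>\<lfloor>(N + 1) p\<rfloor>\<close>, as the ratio of
  consecutive probabilities shows.  The largest of \<open>N + 1\<close> numbers with sum 1 is at least
  their average, and so the binomial coefficient at the mode is
  \<open>2\<close> to the power \<open>N h(p)\<close> up to a factor of order
  \<open>N\<close>.
\<close>
lemma binomial_mode:
  fixes p :: real
  assumes p: "0 < p" "p < 1"
  defines "t \<equiv> \<lambda>N j. real (N choose j) * p ^ j * (1 - p) ^ (N - j)"
  defines "k \<equiv> \<lambda>N. nat \<lfloor>real (N + 1) * p\<rfloor>"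
  shows "k N \<le> N" and "1 \<le> real (N + 1) * t N (k N)"
proof -
  have fl: "real (k N) \<le> real (N + 1) * p" "real (N + 1) * p < real (k N) + 1"
    using p unfolding k_def by (simp_all add: of_nat_floor)
  have "real (N + 1) * p < real (N + 1)" using p by simp
  with fl(1) have "real (k N) < real (N + 1)" by linarith
  then show kN: "k N \<le> N" by simp
  have ratio: "t N (Suc j) * (real (Suc j) * (1 - p)) = t N j * (real (N - j) * p)" if "j < N" for j
  proof -
    have "N - j = Suc (N - Suc j)" using that by simp
    then have pw: "(1 - p) ^ (N - j) = (1 - p) * (1 - p) ^ (N - Suc j)" by simp
    have "Suc j * (N choose Suc j) = (N - j) * (N choose j)"
      using binomial_absorb_comp[of N j] binomial_absorption[of j N] that by simp
    then have eq: "real (Suc j) * real (N choose Suc j) = real (N - j) * real (N choose j)"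
      by (metis of_nat_mult)
    have "t N (Suc j) * (real (Suc j) * (1 - p)) = (real (Suc j) * real (N choose Suc j))
        * (p * p ^ j * (1 - p) ^ (N - Suc j) * (1 - p))"
      unfolding t_def power_Suc by (simp only: mult_ac)
    also have "\<dots> = t N j * (real (N - j) * p)"
      unfolding t_def pw eq by (simp only: mult_ac)
    finally show ?thesis .
  qed
  have t0: "t N j \<ge> 0" for j using p by (simp add: t_def)
  have up: "t N j \<le> t N (Suc j)" if "Suc j \<le> k N" for j
  proof -
    have j: "j < N" using that kN by simp
    have "real (Suc j) \<le> real (N + 1) * p" using that fl(1) by linarith
    then have "real (Suc j) * (1 - p) \<le> real (N - j) * p"
      using j by (simp add: of_nat_diff algebra_simps)
    then have "t N j * (real (Suc j) * (1 - p)) \<le> t N j * (real (N - j) * p)"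
      using t0 by (intro mult_left_mono)
    also have "\<dots> = t N (Suc j) * (real (Suc j) * (1 - p))" using ratio[OF j] by simp
    finally show ?thesis using p by (simp add: mult_le_cancel_right)
  qed
  have down: "t N (Suc j) \<le> t N j" if "k N \<le> j" "j < N" for j
  proof -
    have "real (N + 1) * p \<le> real (Suc j)" using that fl(2) by linarith
    then have "real (N - j) * p \<le> real (Suc j) * (1 - p)"
      using that by (simp add: of_nat_diff algebra_simps)
    then have "t N j * (real (N - j) * p) \<le> t N j * (real (Suc j) * (1 - p))"
      using t0 by (intro mult_left_mono)
    with ratio[OF that(2)] have "t N (Suc j) * (real (Suc j) * (1 - p)) \<le> t N j * (real (Suc j) * (1 - p))"
      by simp
    then show ?thesis using p by (simp add: mult_le_cancel_right)
  qed
  have "t N j \<le> t N (k N)" if "j \<le> N" for j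
  proof (cases "j \<le> k N")
    case True
    then show ?thesis
    proof (induction rule: inc_induct)
      case (step i)
      then show ?case using up[of i] by simp
    qed simp
  next
    case False
    then have "k N \<le> j" by simp
    then show ?thesis using that
    proof (induction rule: dec_induct)
      case (step i)
      then show ?case using down[of i] by simp
    qed simp
  qed
  then have "(\<Sum>j\<le>N. t N j) \<le> real (card {..N}) * t N (k N)"
    by (intro sum_bounded_above) auto
  also have "(\<Sum>j\<le>N. t N j) = 1"
    using binomial_ring[of p "1 - p" N] by (simp add: t_def)
  finally show "1 \<le> real (N + 1) * t N (k N)" by simp
qed

text \<open>
  With \<open>R = log 2 (n^2 + 2 n)\<close>, the second factor bounds the logarithm of the cost
  \<open>q\<close> of one block \<open>A^k \<boxtimes> B^(N - k)\<close> (the summand 1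
  pays for rounding).  The first factor, called \<open>\<kappa>\<close>, is the number of blocks per unit of the
  target exponent: the edges of weight \<open>n\<close> require \<open>1 / k\<close>, and the edge
  \<open>{1, 2}\<close> requires \<open>((1 - p) / p) / (N - k)\<close>.  Both are close to
  \<open>1 / (p N)\<close> if \<open>k\<close> is close to \<open>p N\<close>.
\<close>
lemma schoenhage_exponent_limit:
  fixes p R :: real
  assumes p: "0 < p" "p < 1"
  defines "\<kappa> \<equiv> \<lambda>N k. max (1 / real k) ((1 - p) / p / real (N - k))"
  assumes \<epsilon>: "\<epsilon> > 0"
  shows "\<exists>N k. 0 < k \<and> k < N \<and>
    \<kappa> N k * (1 + real N * R - log 2 (real (N choose k))) \<le> (R - binary_entropy p) / p + \<epsilon>"
proof -
  define k where "k N = nat \<lfloor>real (N + 1) * p\<rfloor>" for N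
  define f where "f N = real (k N) / real N" for N
  define g where "g N = 1 / real N + R + log 2 (real N + 1) / real N + f N * log 2 p + (1 - f N) * log 2 (1 - p)" for N
  have f: "f \<longlonglongrightarrow> p"
  proof (rule tendsto_sandwich)
    show "\<forall>\<^sub>F N in sequentially. (real (N + 1) * p - 1) / real N \<le> f N"
      using eventually_gt_at_top[of 0]
    proof eventually_elim
      case (elim N)
      have "real (N + 1) * p - 1 \<le> real (k N)" using p unfolding k_def by linarith
      then show ?case unfolding f_def by (intro divide_right_mono) auto
    qed
    show "\<forall>\<^sub>F N in sequentially. f N \<le> (real (N + 1) * p) / real N"
      using eventually_gt_at_top[of 0]
    proof eventually_elim
      case (elim N)
      have "real (k N) \<le> real (N + 1) * p" using p unfolding k_def by (simp add: of_nat_floor)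
      then show ?case unfolding f_def by (intro divide_right_mono) auto
    qed
    show "(\<lambda>N. (real (N + 1) * p - 1) / real N) \<longlonglongrightarrow> p" by real_asymp
    show "(\<lambda>N. (real (N + 1) * p) / real N) \<longlonglongrightarrow> p" by real_asymp
  qed
  have kN: "k N \<le> N" and mode: "1 \<le> real (N + 1) * (real (N choose k N) * p ^ k N * (1 - p) ^ (N - k N))" for N
    using binomial_mode[OF p, of N] unfolding k_def by auto
  define e where "e N = 1 / real N + log 2 (real N + 1) / real N" for N
  have e: "e \<longlonglongrightarrow> 0" unfolding e_def by real_asymp
  have g_eq: "g N = e N + R + f N * log 2 p + (1 - f N) * log 2 (1 - p)" for N
    by (simp add: g_def e_def)
  have "(\<lambda>N. max (1 / f N) ((1 - p) / p / (1 - f N)) * g N)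
      \<longlonglongrightarrow> max (1 / p) ((1 - p) / p / (1 - p)) * (0 + R + p * log 2 p + (1 - p) * log 2 (1 - p))"
    unfolding g_eq using p by (intro tendsto_intros e f) auto
  also have "max (1 / p) ((1 - p) / p / (1 - p)) * (0 + R + p * log 2 p + (1 - p) * log 2 (1 - p))
      = (R - binary_entropy p) / p"
    using p by (simp add: binary_entropy_def)
  finally have "\<forall>\<^sub>F N in sequentially. max (1 / f N) ((1 - p) / p / (1 - f N)) * g N
      < (R - binary_entropy p) / p + \<epsilon>"
    using \<epsilon> by (intro order_tendstoD(2)) auto
  moreover have "\<forall>\<^sub>F N in sequentially. f N > 0" using f p by (intro order_tendstoD(1)) auto
  moreover have "\<forall>\<^sub>F N in sequentially. f N < 1" using f p by (intro order_tendstoD(2)) auto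
  ultimately have "\<forall>\<^sub>F N in sequentially. N > 0 \<and> f N > 0 \<and> f N < 1 \<and>
      max (1 / f N) ((1 - p) / p / (1 - f N)) * g N < (R - binary_entropy p) / p + \<epsilon>"
    using eventually_gt_at_top[of 0] by eventually_elim auto
  then obtain N where N: "N > 0" "f N > 0" "f N < 1"
    "max (1 / f N) ((1 - p) / p / (1 - f N)) * g N < (R - binary_entropy p) / p + \<epsilon>"
    using eventually_happens'[OF sequentially_bot] by blast
  have k: "0 < k N" "k N < N" using N(1-3) by (auto simp: f_def zero_less_divide_iff divide_less_eq)
  have kap: "\<kappa> N (k N) = max (1 / f N) ((1 - p) / p / (1 - f N)) / real N"
  proof -
    have "1 - f N = real (N - k N) / real N"
      using N(1) kN[of N] by (simp add: f_def of_nat_diff field_simps)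
    then have "(1 - p) / p / (1 - f N) / real N = (1 - p) / p / real (N - k N)"
      using N(1) by simp
    moreover have "1 / f N / real N = 1 / real (k N)" using N(1) by (simp add: f_def)
    ultimately show ?thesis unfolding \<kappa>_def by (simp only: max_divide_distrib_right) simp
  qed
  have "1 + real N * R - log 2 (real (N choose k N)) \<le> real N * g N"
  proof -
    have pos: "real (N choose k N) > 0" using kN by simp
    have "0 \<le> log 2 (real (N + 1) * (real (N choose k N) * p ^ k N * (1 - p) ^ (N - k N)))"
      using mode[of N] by (subst zero_le_log_cancel_iff) auto
    also have "\<dots> = log 2 (real N + 1) + log 2 (real (N choose k N)) + real (k N) * log 2 p
        + real (N - k N) * log 2 (1 - p)"
      using pos p by (simp add: log_mult log_nat_power add_ac)
    finally have "- log 2 (real (N choose k N)) \<le> log 2 (real N + 1) + real (k N) * log 2 p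
        + real (N - k N) * log 2 (1 - p)" by simp
    moreover have "real N * g N = 1 + real N * R + (log 2 (real N + 1) + real (k N) * log 2 p
        + real (N - k N) * log 2 (1 - p))"
      using N(1) kN[of N] by (simp add: g_def f_def of_nat_diff field_simps)
    ultimately show ?thesis by linarith
  qed
  then have "\<kappa> N (k N) * (1 + real N * R - log 2 (real (N choose k N))) \<le> \<kappa> N (k N) * (real N * g N)"
    using p by (intro mult_left_mono) (auto simp: \<kappa>_def le_max_iff_disj)
  also have "\<dots> = max (1 / f N) ((1 - p) / p / (1 - f N)) * g N"
    using N(1) by (simp add: kap)
  finally show ?thesis using N(4) k by (intro exI[of _ N] exI[of _ "k N"]) auto
qed

text \<open>
  The error function is the excess of the logarithm of the border rank over \<open>c * M\<close>.  It is
  defined with the rounded weight \<open>\<lfloor>m^M\<rfloor>\<close>, so that the hypothesis controls it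
  for every large \<open>M\<close>, whether or not \<open>m^M\<close> is an integer.
\<close>
lemma multiEMaMu_exponent_leI:
  assumes "\<And>\<epsilon>. \<epsilon> > 0 \<Longrightarrow> \<exists>M0. \<forall>M\<ge>M0. \<forall>a b. real a = n ^ M \<longrightarrow> real b \<le> m ^ M \<longrightarrow>
      real (multiEMaMu_border_rank d a b) \<le> 2 powr ((c + \<epsilon>) * real M)"
    and n: "n = real n'" and m: "m \<ge> 0"
  shows "multiEMaMu_exponent_le d n m c"
proof -
  define F where "F M = multiEMaMu_border_rank d (n' ^ M) (nat \<lfloor>m ^ M\<rfloor>)" for M
  define f where "f M = (if F M = 0 then 0 else max 0 (log 2 (real (F M)) - c * real M))" for M
  have "f \<in> o(\<lambda>N. real N)"
  proof (rule landau_o.smallI)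
    fix \<epsilon> :: real assume \<epsilon>: "\<epsilon> > 0"
    obtain M0 where M0: "\<forall>M\<ge>M0. \<forall>a b. real a = n ^ M \<longrightarrow> real b \<le> m ^ M \<longrightarrow>
      real (multiEMaMu_border_rank d a b) \<le> 2 powr ((c + \<epsilon>) * real M)" using assms(1)[OF \<epsilon>] by blast
    show "\<forall>\<^sub>F M in sequentially. norm (f M) \<le> \<epsilon> * norm (real M)"
      using eventually_ge_at_top[of M0]
    proof eventually_elim
      case (elim M)
      have "real (F M) \<le> 2 powr ((c + \<epsilon>) * real M)"
        unfolding F_def using M0[rule_format, OF elim, of "n' ^ M" "nat \<lfloor>m ^ M\<rfloor>"] m n
        by (simp add: of_nat_floor)
      then have "log 2 (real (F M)) \<le> (c + \<epsilon>) * real M" if "F M \<noteq> 0"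
        using that by (subst log_le_iff) auto
      then show ?case using \<epsilon> by (auto simp: f_def algebra_simps)
    qed
  qed
  moreover have "real (multiEMaMu_border_rank d a b) \<le> 2 powr (c * real M + f M)"
    if "n ^ M = real a" "m ^ M = real b" for M a b
  proof -
    have "a = n' ^ M" using that(1) n by (metis of_nat_eq_iff of_nat_power)
    then have F: "multiEMaMu_border_rank d a b = F M" by (simp add: F_def that(2))
    show ?thesis
    proof (cases "F M = 0")
      case False
      then have "log 2 (real (F M)) \<le> c * real M + f M" by (simp add: f_def)
      then have "2 powr (log 2 (real (F M))) \<le> 2 powr (c * real M + f M)" by simp
      then show ?thesis using False by (simp add: F)
    qed (simp add: F)
  qed
  ultimately show ?thesis unfolding multiEMaMu_exponent_le_def by blast
qed

text \<open>
  \<open>N\<close> and \<open>k\<close> are fixed first, close enough to the limit for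
  \<open>\<epsilon> / 2\<close>; the other \<open>\<epsilon> / 2\<close> absorbs the terms
  \<open>C\<close> that do not grow with \<open>M\<close>.
\<close>
lemma multiEMaMu_border_rank_asymptotic:
  fixes n d :: nat and p \<epsilon> :: real
  assumes d: "d \<ge> 2" and n: "n > 0" and p: "0 < p" "p < 1" and \<epsilon>: "\<epsilon> > 0"
  defines "c \<equiv> (log 2 (real n ^ 2 + 2 * real n) + real (d - 2) * log 2 (real n) - binary_entropy p) / p"
  shows "\<exists>M0. \<forall>M\<ge>M0. \<forall>b. real b \<le> real n powr (real d * ((1 - p) / p * real M)) \<longrightarrow>
    real (multiEMaMu_border_rank d (n ^ M) b) \<le> 2 powr ((c + \<epsilon>) * real M)"
proof -
  define R where "R = log 2 (real n ^ 2 + 2 * real n)"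
  define \<rho> where "\<rho> = (1 - p) / p"
  obtain N k where k: "0 < k" "k < N" and lim:
    "max (1 / real k) (\<rho> / real (N - k)) * (1 + real N * R - log 2 (real (N choose k)))
      \<le> (R - binary_entropy p) / p + \<epsilon> / 2"
    using schoenhage_exponent_limit[OF p, of "\<epsilon> / 2" R] \<epsilon> unfolding \<rho>_def by auto
  define \<kappa> where "\<kappa> = max (1 / real k) (\<rho> / real (N - k))"
  define s where "s = (N choose k)"
  define r where "r = (n ^ 2 + 2 * n) ^ N"
  define q where "q = r div s + 1"
  have \<rho>: "\<rho> > 0" using p by (simp add: \<rho>_def)
  have \<kappa>: "\<kappa> > 0" "1 \<le> real k * \<kappa>" "\<rho> \<le> real (N - k) * \<kappa>"
    using k by (auto simp: \<kappa>_def less_max_iff_disj le_max_iff_disj field_simps max_mult_distrib_left)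
  have s: "s > 0" using k by (simp add: s_def)
  have "s \<le> 2 ^ N" unfolding s_def by (rule binomial_le_pow2)
  also have "(2::nat) ^ N \<le> r"
    unfolding r_def using n by (intro power_mono) auto
  finally have sr: "s \<le> r" .
  have rq: "r \<le> s * q"
    using dividend_less_times_div[OF s, of r] unfolding q_def by simp
  define \<mu> where "\<mu> = log 2 (real q)"
  have \<mu>0: "\<mu> \<ge> 0" by (simp add: \<mu>_def q_def)
  have "real q \<le> 2 * real r / real s"
  proof -
    have "real (r div s) \<le> real r / real s" by (rule of_nat_div_le_of_nat)
    moreover have "1 \<le> real r / real s" using sr s by simp
    ultimately show ?thesis by (simp add: q_def)
  qed
  then have "\<mu> \<le> log 2 (2 * real r / real s)"
    unfolding \<mu>_def using s sr by (subst log_le_cancel_iff) (auto simp: q_def)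
  also have "\<dots> = 1 + real N * R - log 2 (real s)"
  proof -
    have "real n ^ 2 + 2 * real n > 0" using n by (intro add_pos_pos) auto
    then show ?thesis using s by (simp add: log_divide log_mult r_def R_def log_nat_power)
  qed
  finally have "\<kappa> * \<mu> \<le> \<kappa> * (1 + real N * R - log 2 (real s))"
    using \<kappa>(1) by (intro mult_left_mono) auto
  also have "\<dots> \<le> (R - binary_entropy p) / p + \<epsilon> / 2"
    using lim by (simp add: \<kappa>_def s_def)
  finally have \<kappa>\<mu>: "\<kappa> * \<mu> \<le> (R - binary_entropy p) / p + \<epsilon> / 2" .
  define D where "D = real (d - 2) * log 2 (real n)"
  have D0: "D \<ge> 0" using n by (simp add: D_def)
  define C where "C = log 2 (real s) + 2 * \<mu> + D"
  show ?thesis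
  proof (intro exI allI impI)
    fix M b assume M: "M \<ge> nat \<lceil>2 * C / \<epsilon>\<rceil>"
      and b: "real b \<le> real n powr (real d * ((1 - p) / p * real M))"
    (* The weight of the edge {1, 2} is rounded up to a power of n, and one more block than
       \<kappa> * M requires makes up for this rounding. *)
    define J where "J = nat \<lceil>\<rho> * real M\<rceil>"
    define K where "K = nat \<lceil>\<kappa> * real M\<rceil> + 1"
    have J: "\<rho> * real M \<le> real J" "real J \<le> \<rho> * real M + 1"
      using \<rho> unfolding J_def by (simp_all add: real_nat_ceiling_ge of_nat_ceiling)
    have K: "\<kappa> * real M + 1 \<le> real K" "real K \<le> \<kappa> * real M + 2"
    proof -
      have "0 \<le> \<kappa> * real M" using \<kappa>(1) by simp
      then show "\<kappa> * real M + 1 \<le> real K" "real K \<le> \<kappa> * real M + 2"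
        unfolding K_def by linarith+
    qed
    have "real M \<le> real k * (\<kappa> * real M)"
      using mult_right_mono[OF \<kappa>(2), of "real M"] by (simp add: mult_ac)
    also have "\<dots> \<le> real k * real K" using K(1) by (intro mult_left_mono) auto
    finally have MK: "M \<le> k * K" by (metis of_nat_le_iff of_nat_mult)
    have "real J \<le> real (N - k) * \<kappa> * real M + real (N - k)"
      using J(2) mult_right_mono[OF \<kappa>(3), of "real M"] k by simp
    also have "\<dots> = real (N - k) * (\<kappa> * real M + 1)" by (simp add: algebra_simps)
    also have "\<dots> \<le> real (N - k) * real K" using K(1) by (intro mult_left_mono) auto
    finally have JK: "J \<le> (N - k) * K" by (metis of_nat_le_iff of_nat_mult)
    have "real b \<le> real n powr (real d * real J)"
      using b J(1) n unfolding \<rho>_def[symmetric]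
      by (elim order_trans, intro powr_mono mult_left_mono) auto
    also have "\<dots> = real (n ^ (d * J))"
      using n by (simp add: powr_realpow[symmetric])
    finally have bJ: "b \<le> n ^ (d * J)" by simp
    have "multiEMaMu_border_rank d (n ^ M) b \<le> s * q ^ K * n ^ ((d - 2) * (J + M))"
      unfolding s_def using k rq
      by (intro multiEMaMu_border_rank_power_le[OF d n _ MK JK bJ]) (auto simp: s_def r_def)
    then have "real (multiEMaMu_border_rank d (n ^ M) b)
        \<le> real (s * q ^ K * n ^ ((d - 2) * (J + M)))" by (rule of_nat_mono)
    also have "\<dots> = 2 powr (log 2 (real (s * q ^ K * n ^ ((d - 2) * (J + M)))))"
      using s n by (simp add: q_def)
    also have "log 2 (real (s * q ^ K * n ^ ((d - 2) * (J + M))))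
        = log 2 (real s) + real K * \<mu> + real (J + M) * D"
      using s n by (simp add: log_mult log_nat_power \<mu>_def D_def q_def)
    also have "\<dots> \<le> (c + \<epsilon>) * real M"
    proof -
      have "real K * \<mu> \<le> \<kappa> * \<mu> * real M + 2 * \<mu>"
        using mult_right_mono[OF K(2) \<mu>0] by (simp add: algebra_simps)
      also have "\<dots> \<le> ((R - binary_entropy p) / p + \<epsilon> / 2) * real M + 2 * \<mu>"
        using mult_right_mono[OF \<kappa>\<mu>, of "real M"] by simp
      finally have 1: "real K * \<mu> \<le> ((R - binary_entropy p) / p + \<epsilon> / 2) * real M + 2 * \<mu>" .
      have "real (J + M) \<le> real M / p + 1"
        using J(2) p by (simp add: \<rho>_def field_simps)
      from mult_right_mono[OF this D0] have 2: "real (J + M) * D \<le> D / p * real M + D"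
        by (simp add: algebra_simps)
      have "2 * C / \<epsilon> \<le> real M" using M by linarith
      then have 3: "C \<le> \<epsilon> / 2 * real M" using \<epsilon> by (simp add: field_simps)
      have "c = (R - binary_entropy p) / p + D / p"
        unfolding c_def R_def D_def by (simp add: add_divide_distrib diff_divide_distrib)
      then have "(c + \<epsilon>) * real M
          = ((R - binary_entropy p) / p + \<epsilon> / 2) * real M + D / p * real M + \<epsilon> / 2 * real M"
        by (simp add: algebra_simps)
      then show ?thesis using 1 2 3 unfolding C_def by linarith
    qed
    finally show "real (multiEMaMu_border_rank d (n ^ M) b) \<le> 2 powr ((c + \<epsilon>) * real M)" by simp
  qed
qed

text \<open>
  The right hand side is the base of the logarithm in the theorem; the left hand side is the rank bound
  of Schoenhage's tensor times the weights of the \<open>d - 2\<close> edges at the factors from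
  \<open>3\<close> to \<open>d\<close>.
\<close>
lemma exponent_base_le:
  fixes x :: real
  assumes "x \<ge> 1" "d \<ge> 3"
  shows "(x ^ 2 + 2 * x) * x ^ (d - 2) \<le> x ^ d + 2 * x ^ (d - 1) + x ^ 2 * (x + 1) ^ (d - 3) + 1"
proof -
  have "d = Suc (Suc (d - 2))" "d - 1 = Suc (d - 2)" using assms by auto
  then have "x ^ d = x ^ 2 * x ^ (d - 2)" "x ^ (d - 1) = x * x ^ (d - 2)"
    by (metis power_Suc power2_eq_square mult.assoc)+
  moreover have "0 \<le> x ^ 2 * (x + 1) ^ (d - 3)" using assms by simp
  ultimately show ?thesis by (simp add: algebra_simps)
qed

theorem theorem4p2:
  fixes n d :: nat and p :: real
  assumes "d \<ge> 3" and "0 < p" and "p < 1"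
  shows "multiEMaMu_exponent_le d (real n) (real n powr (real d * ((1 - p) / p)))
           (1 / p * (log 2 (real n ^ d + 2 * real n ^ (d - 1)
                             + real n ^ 2 * (real n + 1) ^ (d - 3) + 1)
                     - binary_entropy p))" (is "multiEMaMu_exponent_le _ _ _ ?c")
proof (rule multiEMaMu_exponent_leI)
  fix \<epsilon> :: real assume \<epsilon>: "\<epsilon> > 0"
  show "\<exists>M0. \<forall>M\<ge>M0. \<forall>a b. real a = real n ^ M \<longrightarrow>
      real b \<le> (real n powr (real d * ((1 - p) / p))) ^ M \<longrightarrow>
      real (multiEMaMu_border_rank d a b) \<le> 2 powr ((?c + \<epsilon>) * real M)"
  proof (cases "n = 0")
    case True
    have "multiEMaMu_border_rank d 0 b = 0" for b
      using multiEMaMu_border_rank_le[of d 0 b 0] assms(1)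
      by (simp add: matmul_copies_rank_le_def rank3_le_def)
    then show ?thesis using True by (intro exI[of _ 1]) (auto simp: power_0_left)
  next
    case False
    define c where "c = (log 2 (real n ^ 2 + 2 * real n) + real (d - 2) * log 2 (real n)
      - binary_entropy p) / p"
    have "real n ^ 2 + 2 * real n > 0" using False by (intro add_pos_pos) auto
    then have "log 2 (real n ^ 2 + 2 * real n) + real (d - 2) * log 2 (real n)
        = log 2 ((real n ^ 2 + 2 * real n) * real n ^ (d - 2))"
      using False by (simp add: log_mult log_nat_power)
    also have "\<dots> \<le> log 2 (real n ^ d + 2 * real n ^ (d - 1)
        + real n ^ 2 * (real n + 1) ^ (d - 3) + 1)"
      using False assms(1) exponent_base_le[of "real n" d] by (intro log_mono) (auto simp: add_pos_pos)
    finally have "c \<le> ?c" using assms(2) by (simp add: c_def divide_right_mono)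
    then have mono: "2 powr ((c + \<epsilon>) * real M) \<le> 2 powr ((?c + \<epsilon>) * real M)" for M
      by (intro powr_mono mult_right_mono) auto
    obtain M0 where M0: "\<forall>M\<ge>M0. \<forall>b. real b \<le> real n powr (real d * ((1 - p) / p * real M)) \<longrightarrow>
        real (multiEMaMu_border_rank d (n ^ M) b) \<le> 2 powr ((c + \<epsilon>) * real M)"
      using multiEMaMu_border_rank_asymptotic[of d n p \<epsilon>] False assms \<epsilon> unfolding c_def by auto
    show ?thesis
    proof (intro exI allI impI)
      fix M a b assume M: "M \<ge> M0" and a: "real a = real n ^ M"
        and b: "real b \<le> (real n powr (real d * ((1 - p) / p))) ^ M"
      have "a = n ^ M" using a by (metis of_nat_eq_iff of_nat_power)
      moreover have "real b \<le> real n powr (real d * ((1 - p) / p * real M))"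
        using b False by (simp add: powr_realpow[symmetric] powr_powr mult.assoc)
      ultimately show "real (multiEMaMu_border_rank d a b) \<le> 2 powr ((?c + \<epsilon>) * real M)"
        using M0 M mono order_trans by blast
    qed
  qed
qed auto

end
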